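(* Let $n\ge2$, $p\ge1$, let $\mathcal G$ be a connected weighted undirected graph on $[n]$ with Laplacian matrix $L=(L_{ij})$, and let $f_i:\mathbb{R}^p\to\mathbb{R}$, $i\in[n]$, be differentiable functions. Put $f(x)=\sum_{i=1}^n f_i(x)$ for $x\in\mathbb{R}^p$ and $\tilde f(\boldsymbol{x})=\sum_{i=1}^n f_i(x_i)$ for $\boldsymbol{x}=\mathrm{col}(x_1,\dots,x_n)\in\mathbb{R}^{np}$. Let $X^*$ be the set of global minimizers of $f$ over $\mathbb{R}^p$ and $\boldsymbol{X}^*=\{\mathbf{1}_n\otimes x^*:x^*\in X^*\}$. Assume: (i) $X^*$ is nonempty and convex; (ii) for each $i\in[n]$ there is $L_{f_i}>0$ with $\|\nabla f_i(a)-\nabla f_i(b)\|\le L_{f_i}\|a-b\|$ for all $a,b\in\mathbb{R}^p$; let $L_f=\max_{i\in[n]}L_{f_i}$; (iii) $f$ satisfies the restricted secant inequality condition with constant $\nu>0$; (iv) the set $\{\nabla\tilde f(\boldsymbol{x}):\boldsymbol{x}\in\boldsymbol{X}^*\}$ is a singleton. Let $\alpha>\frac{2nL_f^2+\nu L_f}{\nu\rho_2(L)}$, $\beta>0$, and define $$\nu_1=\min\Big\{\frac{\nu}{2n},\ \alpha\rho_2(L)-\frac{2nL_f^2+\nu L_f}{\nu}\Big\},\qquad \epsilon_1=\max\Big\{\frac1{\nu_1}\Big(\frac{L_f^2}{2\beta}+\rho(L)\beta\Big),\ \frac{\beta}{\alpha}\Big\},$$ $$\epsilon_2=\min\Big\{\frac{\beta}{2},\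 \epsilon_1\nu_1\Big\},\qquad \epsilon_3=\max\Big\{\frac{\epsilon_1}{\rho_2(L)}+\frac{\alpha}{2\beta}+\frac12,\ \epsilon_1+\frac12\Big\},$$ $$\epsilon_4=\epsilon_1\min\Big\{\frac1{\rho(L)},\ \frac12\Big\},\qquad \epsilon_5=\max\{\beta^2\rho^2(L)+3\alpha^2\rho^2(L)+3L_f^2,\ 3\beta^2\},$$ $$\eta=\sqrt2\,\max\Big\{\frac{2\epsilon_1}{\rho_2(L)}+\alpha+1,\ 4\epsilon_1+1\Big\}>0.$$ Let $0<h<\frac{2\epsilon_2\epsilon_4}{\eta\epsilon_3\epsilon_5}$, and let the sequences $x_i(k),v_i(k)\in\mathbb{R}^p$, $i\in[n]$, $k=0,1,2,\dots$, be generated by $$x_i(k+1)=x_i(k)-h\Big(\alpha\sum_{j=1}^nL_{ij}x_j(k)+\beta v_i(k)+\nabla f_i(x_i(k))\Big),\qquad v_i(k+1)=v_i(k)+h\beta\sum_{j=1}^nL_{ij}x_j(k),$$ with arbitrary $x_i(0)\in\mathbb{R}^p$ and $v_i(0)=\mathbf{0}_p$. Then $\boldsymbol{x}(k)=\mathrm{col}(x_1(k),\dots,x_n(k))$ converges linearly to $\boldsymbol{X}^*$ with a rate no less than $1-\frac{h(2\epsilon_2\epsilon_4-h\eta\epsilon_3\epsilon_5)}{4\epsilon_3\epsilon_4}$, i.e., there is a constant $C\ge0$ (depending on the initial condition) such that $$\|\boldsymbol{x}(k)-\mathcal{P}_{\boldsymbol{X}^*}(\boldsymbol{x}(k))\|\le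 C\Big(1-\frac{h(2\epsilon_2\epsilon_4-h\eta\epsilon_3\epsilon_5)}{4\epsilon_3\epsilon_4}\Big)^k\quad\text{for all }k\ge0.$$
   Context: $[n]=\{1,\dots,n\}$; $\mathrm{col}(x_1,\dots,x_n)$ is the concatenated column vector; $\mathbf{1}_n$ is the all-ones vector in $\mathbb{R}^n$ and $\mathbf{0}_p$ the zero vector in $\mathbb{R}^p$; $\otimes$ is the Kronecker product; $\|\cdot\|$ is the Euclidean norm. Graph: a weighted undirected graph on $[n]$ is given by a symmetric weighted adjacency matrix $A=(a_{ij})$ with $a_{ij}\ge 0$ and $a_{ii}=0$; $i$ and $j$ are joined by an edge iff $a_{ij}>0$. The graph is connected if there is a path between any two vertices. Its Laplacian is $L=\mathrm{diag}(\deg_1,\dots,\deg_n)-A$ with $\deg_i=\sum_{j=1}^n a_{ij}$. $\rho(L)$ denotes the spectral radius of $L$ (and $\rho^2(L)=(\rho(L))^2$), and $\rho_2(L)$ its smallest positive eigenvalue. Projection: for a nonempty closed convex set $S$, $\mathcal{P}_S(x)=\arg\min_{y\in S}\|x-y\|^2$. Restricted secant inequality: a differentiable function $f:\mathbb{R}^p\to\mathbb{R}$ with set of global minimizers $X^*$ satisfies the restricted secant inequality condition with constant $\nu>0$ if $$(\nabla f(x)-\nabla f(\mathcal{P}_{X^*}(x)))^\top(x-\mathcal{P}_{X^*}(x))\ge\nu\|x-\mathcal{P}_{X^*}(x)\|^2\quad\text{for all }x\in\mathbb{R}^p.$$ No convexity of $f$ or of the $f_i$ is assumed. *)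

theory Defs
  imports "HOL-Analysis.Analysis"
begin

text \<open>
  Vertices are the elements of a finite type \<open>'n\<close>. A stacked vector
  \<open>col(x_1, ..., x_n)\<close> of \<open>n\<close> vectors of \<open>real ^ 'p\<close> is an element \<open>x\<close> of
  \<open>real ^ 'p ^ 'n\<close> with blocks \<open>x $ i\<close>. The norm of this type is the square root of the
  sum of the squared norms of the blocks, that is, the Euclidean norm of the
  stacked vector with \<open>n p\<close> entries.
\<close>

definition global_minimizers :: "('a \<Rightarrow> real) \<Rightarrow> 'a set" where
  "global_minimizers f = {x. \<forall>y. f x \<le> f y}"

text \<open>The gradient is uniquely determined, hence meaningful, at every point of differentiability.\<close>

definition gradient :: "('a::real_inner \<Rightarrow> real) \<Rightarrow> 'a \<Rightarrow> 'a" where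
  "gradient f x = (THE D. GDERIV f x :> D)"

text \<open>
  \<open>closest_point S x\<close> is the projection onto \<open>S\<close> when \<open>S\<close> is nonempty, closed and convex;
  the condition below is only meant for functions whose set of global minimizers is of this kind.
\<close>

definition restricted_secant :: "('a::euclidean_space \<Rightarrow> real) \<Rightarrow> real \<Rightarrow> bool" where
  "restricted_secant f \<nu> \<longleftrightarrow> \<nu> > 0 \<and> (\<forall>x. f differentiable (at x)) \<and>
     (\<forall>x. let y = closest_point (global_minimizers f) x
          in (gradient f x - gradient f y) \<bullet> (x - y) \<ge> \<nu> * (norm (x - y))\<^sup>2)"

definition weighted_adjacency :: "real ^ 'n ^ 'n \<Rightarrow> bool" where
  "weighted_adjacency A \<longleftrightarrow>
     (\<forall>i j. A $ i $ j = A $ j $ i) \<and> (\<forall>i j. A $ i $ j \<ge> 0) \<and> (\<forall>i. A $ i $ i = 0)"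

definition edge_rel :: "real ^ 'n ^ 'n \<Rightarrow> ('n \<times> 'n) set" where
  "edge_rel A = {(i, j). A $ i $ j > 0}"

definition connected_graph :: "real ^ 'n ^ 'n \<Rightarrow> bool" where
  "connected_graph A \<longleftrightarrow> (\<forall>i j. (i, j) \<in> (edge_rel A)\<^sup>*)"

definition laplacian :: "real ^ 'n ^ 'n \<Rightarrow> real ^ 'n ^ 'n" where
  "laplacian A = (\<chi> i j. (if i = j then (\<Sum>k\<in>UNIV. A $ i $ k) else 0) - A $ i $ j)"

definition eigenvalues :: "'a::field ^ 'n ^ 'n \<Rightarrow> 'a set" where
  "eigenvalues M = {c. \<exists>v. v \<noteq> 0 \<and> M *v v = c *s v}"

text \<open>As usual, the spectral radius of a real matrix takes its complex eigenvalues into account.\<close>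

definition spectral_radius :: "real ^ 'n ^ 'n \<Rightarrow> real" where
  "spectral_radius M = Max (cmod ` eigenvalues (map_matrix complex_of_real M))"

definition min_pos_eigenvalue :: "real ^ 'n ^ 'n \<Rightarrow> real" where
  "min_pos_eigenvalue M = Min {c \<in> eigenvalues M. c > 0}"

end

theory Submission
  imports Defs
begin

text \<open>
  Write \<open>T\<close> for the Laplacian acting on stacked vectors, \<open>y\<close> for the difference of \<open>x k\<close> and its projection
  onto the consensus solutions, and \<open>w\<close> for the difference of \<open>v k\<close> and the equilibrium
  \<open>- G /\<^sub>R \<beta>\<close>, where \<open>G\<close> is the common value of the stacked gradient at the solutions. That \<open>G\<close> does not
  depend on the solution makes \<open>w\<close> well defined while the projection moves from step to step.
  In these variables one step leads to \<open>y + h d\<close> with \<open>d = - (\<alpha> T y + \<beta> w + g)\<close>, up to reprojection, and to \<open>w + h \<beta> T y\<close>,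
  where \<open>g\<close> is the gradient difference between \<open>x k\<close> and its projection.

  The decrease comes from coercivity: \<open>\<alpha> (T y \<bullet> y) + g \<bullet> y \<ge> \<nu>\<^sub>1 \<parallel>y\<parallel>\<^sup>2\<close>
  (\<open>laplacian_plus_gradient_coercive\<close>). The secant inequality acts on the block mean of the error only,
  and the Laplacian makes up for the rest because it is bounded below by \<open>\<rho>\<^sub>2\<close> on mean-free vectors.
  This alone does not control \<open>w\<close>, so the function
  \<open>V = \<epsilon>\<^sub>1 \<parallel>y\<parallel>\<^sup>2 + \<epsilon>\<^sub>1 (w \<bullet> T\<^sup>+ w) + \<alpha> / (2 \<beta>) \<parallel>w\<parallel>\<^sup>2 + w \<bullet> y\<close> is used, in which \<open>T\<^sup>+ w\<close> is represented by a
  vector \<open>q\<close> with \<open>T q = w\<close>. It lies between \<open>\<epsilon>\<^sub>4\<close> and \<open>\<epsilon>\<^sub>3\<close> times \<open>\<parallel>y\<parallel>\<^sup>2 + \<parallel>w\<parallel>\<^sup>2\<close>, and one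
  step changes it by at most \<open>- h \<epsilon>\<^sub>2 + h\<^sup>2 \<eta> \<epsilon>\<^sub>5 / 2\<close> times this quantity (\<open>lyapunov_step\<close> with
  \<open>lyapunov_first_order_bound\<close> and \<open>lyapunov_second_order_bound\<close>). Hence \<open>V\<close> contracts by \<open>1 - 2 r\<close>, where
  \<open>1 - r\<close> is the claimed rate, and \<open>\<parallel>y\<parallel>\<close> is at most a constant times the square root of \<open>V\<close>.

  The constants enter through quadratic inequalities between the forms \<open>T a \<bullet> a\<close>,
  \<open>T a \<bullet> T a\<close> and \<open>a \<bullet> a\<close>. They follow from extremal Rayleigh quotients being eigenvalues
  (\<open>min_eigenvector_in_invariant_subspace\<close>).
\<close>

section \<open>Gradients\<close>

lemma gradient_eqI:
  assumes "GDERIV f x :> D"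
  shows "gradient f x = D"
proof -
  have "E = D" if "GDERIV f x :> E" for E
  proof -
    have "(\<lambda>h. h \<bullet> E) = (\<lambda>h. h \<bullet> D)"
      using that assms unfolding gderiv_def by (rule has_derivative_unique)
    then show "E = D"
      by (metis vector_eq_ldot)
  qed
  then show ?thesis
    unfolding gradient_def using assms by (rule the_equality[rotated])
qed

lemma gderiv_gradient:
  fixes f :: "'a::euclidean_space \<Rightarrow> real"
  assumes "f differentiable (at x)"
  shows "GDERIV f x :> gradient f x"
proof -
  obtain f' where f': "(f has_derivative f') (at x)"
    using assms by (auto simp: differentiable_def)
  have lin: "linear f'"
    using f' has_derivative_linear by blast
  define D where "D = (\<Sum>b\<in>Basis. f' b *\<^sub>R b)"
  have "f' h = h \<bullet> D" for h
  proof -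
    have "f' h = f' (\<Sum>b\<in>Basis. (h \<bullet> b) *\<^sub>R b)"
      by (simp add: euclidean_representation)
    also have "\<dots> = (\<Sum>b\<in>Basis. (h \<bullet> b) * f' b)"
      using lin by (simp add: linear_sum linear_cmul)
    also have "\<dots> = h \<bullet> D"
      by (simp add: D_def inner_sum_right mult.commute)
    finally show ?thesis .
  qed
  then have "f' = (\<lambda>h. h \<bullet> D)" by (rule ext)
  then have "GDERIV f x :> D"
    using f' by (simp add: gderiv_def)
  then show ?thesis
    using gradient_eqI by metis
qed

lemma gradient_eq_0_at_global_minimizer:
  fixes f :: "'a::euclidean_space \<Rightarrow> real"
  assumes "f differentiable (at x)" "x \<in> global_minimizers f"
  shows "gradient f x = 0"
proof -
  have "(f has_derivative (\<lambda>h. h \<bullet> gradient f x)) (at x)"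
    using gderiv_gradient[OF assms(1)] by (simp add: gderiv_def)
  then have "(\<lambda>h. h \<bullet> gradient f x) = (\<lambda>h. 0)"
    using assms(2)
    by (intro differential_zero_maxmin[of x UNIV f]) (auto simp: global_minimizers_def)
  then show ?thesis
    by (metis inner_eq_zero_iff)
qed

lemma gderiv_sum:
  assumes "\<And>i. i \<in> I \<Longrightarrow> GDERIV (f i) x :> D i"
  shows "GDERIV (\<lambda>y. \<Sum>i\<in>I. f i y) x :> (\<Sum>i\<in>I. D i)"
  using assms unfolding gderiv_def inner_sum_right by (rule has_derivative_sum)

text \<open>
  The gradient of a sum of functions of separate blocks is the stack of the block gradients;
  this identifies \<open>gradient ft\<close> on the stacked space.
\<close>

lemma gderiv_separable:
  fixes f :: "'n::finite \<Rightarrow> 'a::euclidean_space \<Rightarrow> real"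
  assumes "\<And>i. GDERIV (f i) (x $ i) :> D i"
  shows "GDERIV (\<lambda>y. \<Sum>i\<in>UNIV. f i (y $ i)) x :> (\<chi> i. D i)"
proof -
  have "((\<lambda>y. f i (y $ i)) has_derivative (\<lambda>h. (h $ i) \<bullet> D i)) (at x)" for i
  proof -
    have "((\<lambda>y::'a^'n. y $ i) has_derivative (\<lambda>h. h $ i)) (at x)"
      by (rule bounded_linear.has_derivative[OF bounded_linear_vec_nth]) simp
    from has_derivative_compose[OF this assms[of i, unfolded gderiv_def]]
    show ?thesis .
  qed
  then show ?thesis
    unfolding gderiv_def by (auto simp: inner_vec_def intro!: has_derivative_sum)
qed

section \<open>Extremal eigenvectors\<close>

text \<open>
  The only spectral theory that is needed. A minimizer of the Rayleigh quotient on the unit sphere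
  of an invariant subspace exists by compactness, and it is an eigenvector because the first
  variation vanishes there. Applied to the negated operator it bounds the form from above by an
  eigenvalue; applied on the complement of a kernel it bounds the form from below.
\<close>

lemma min_eigenvector_in_invariant_subspace:
  fixes T :: "'a::euclidean_space \<Rightarrow> 'a"
  assumes lin: "linear T" and selfadj: "\<And>x y. T x \<bullet> y = x \<bullet> T y"
    and S: "subspace S" and inv: "\<And>x. x \<in> S \<Longrightarrow> T x \<in> S"
    and s: "s \<in> S" "s \<noteq> 0"
  obtains u \<mu> where "u \<in> S" "u \<noteq> 0" "T u = \<mu> *\<^sub>R u"
    and "\<And>x. x \<in> S \<Longrightarrow> \<mu> * (x \<bullet> x) \<le> T x \<bullet> x"
proof -
  interpret T: linear T by fact
  have "compact (sphere 0 1 \<inter> S)"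
    using S by (intro compact_Int_closed) (auto simp: closed_subspace)
  moreover have "s /\<^sub>R norm s \<in> sphere 0 1 \<inter> S"
    using s S by (auto simp: subspace_scale)
  moreover have "continuous_on (sphere 0 1 \<inter> S) (\<lambda>x. T x \<bullet> x)"
    using lin by (intro continuous_intros linear_continuous_on)
       (simp add: linear_conv_bounded_linear)
  ultimately obtain u where u: "u \<in> sphere 0 1 \<inter> S"
    and min: "\<And>x. x \<in> sphere 0 1 \<inter> S \<Longrightarrow> T u \<bullet> u \<le> T x \<bullet> x"
    using continuous_attains_inf[of "sphere 0 1 \<inter> S" "\<lambda>x. T x \<bullet> x"] by blast
  define \<mu> where "\<mu> = T u \<bullet> u"
  have rayleigh: "\<mu> * (x \<bullet> x) \<le> T x \<bullet> x" if "x \<in> S" for x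
  proof (cases "x = 0")
    case False
    have "\<mu> \<le> T (x /\<^sub>R norm x) \<bullet> (x /\<^sub>R norm x)"
      unfolding \<mu>_def using False that S by (intro min) (auto simp: subspace_scale)
    also have "\<dots> = T x \<bullet> x / (x \<bullet> x)"
      by (simp add: T.scaleR power2_norm_eq_inner[symmetric] power2_eq_square field_simps)
    finally show ?thesis
      using False by (simp add: field_simps)
  qed (simp add: T.zero)
  define r where "r = T u - \<mu> *\<^sub>R u"
  have uu: "u \<bullet> u = 1" and uS: "u \<in> S"
    using u by (auto simp: dot_square_norm)
  have rS: "r \<in> S"
    unfolding r_def using S inv uS by (intro subspace_diff subspace_scale) auto
  have uTu: "u \<bullet> T u = \<mu>"
    by (simp add: \<mu>_def inner_commute)
  define c where "c = T r \<bullet> r - \<mu> * (r \<bullet> r)"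
  \<comment> \<open>Perturbing \<open>u\<close> in the direction of its residual \<open>r\<close> changes the nonnegative form
    \<open>T x \<bullet> x - \<mu> * (x \<bullet> x)\<close>, which is zero at \<open>u\<close>, by \<open>2 * t * (r \<bullet> r)\<close> to first order;
    a small negative \<open>t\<close> therefore forces \<open>r = 0\<close>.\<close>
  have var: "0 \<le> 2 * t * (r \<bullet> r) + t\<^sup>2 * c" for t
  proof -
    have "u + t *\<^sub>R r \<in> S"
      using S uS rS by (intro subspace_add subspace_scale)
    then have "0 \<le> T (u + t *\<^sub>R r) \<bullet> (u + t *\<^sub>R r) - \<mu> * ((u + t *\<^sub>R r) \<bullet> (u + t *\<^sub>R r))"
      using rayleigh by simp
    also have "\<dots> = 2 * t * (T u \<bullet> r - \<mu> * (u \<bullet> r)) + t\<^sup>2 * c"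
      using selfadj[of r u] uTu
      by (simp add: T.add T.scaleR inner_simps inner_commute uu c_def
           algebra_simps power2_eq_square)
    also have "T u \<bullet> r - \<mu> * (u \<bullet> r) = r \<bullet> r"
      by (simp add: r_def inner_simps inner_commute algebra_simps)
    finally show ?thesis .
  qed
  have "r \<bullet> r = 0"
  proof (rule ccontr)
    assume "r \<bullet> r \<noteq> 0"
    then have a: "r \<bullet> r > 0" by (simp add: less_le)
    define t where "t = (r \<bullet> r) / (\<bar>c\<bar> + 1)"
    have t: "t > 0" using a by (simp add: t_def)
    have "2 * t * (r \<bullet> r) \<le> t * (t * c)"
      using var[of "- t"] by (simp add: power2_eq_square)
    then have "2 * (r \<bullet> r) \<le> t * c"
      using t by (simp add: mult.assoc mult.left_commute[of 2])
    also have "t * c \<le> t * (\<bar>c\<bar> + 1)"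
      using t by (intro mult_left_mono) auto
    also have "\<dots> = r \<bullet> r" by (simp add: t_def)
    finally show False using a by simp
  qed
  then have "T u = \<mu> *\<^sub>R u" by (simp add: r_def)
  moreover have "u \<noteq> 0" using uu by auto
  ultimately show thesis
    using that uS rayleigh by blast
qed

section \<open>Eigenvalues\<close>

text \<open>
  Eigenvectors of distinct eigenvalues are linearly independent: applying \<open>M - d I\<close> to a relation
  removes the term of \<open>d\<close> and multiplies each other coefficient by the nonzero factor \<open>c - d\<close>.
\<close>

lemma eigenvectors_linear_relation_trivial:
  fixes M :: "'a::field^'n^'n"
  assumes "finite S" "\<And>c. c \<in> S \<Longrightarrow> V c \<noteq> 0 \<and> M *v V c = c *s V c"
    and "(\<Sum>c\<in>S. a c *s V c) = 0"
  shows "\<forall>c\<in>S. a c = 0"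
  using assms
proof (induction S arbitrary: a rule: finite_induct)
  case (insert d S)
  have rel: "a d *s V d + (\<Sum>c\<in>S. a c *s V c) = 0"
    using insert.prems(2) insert.hyps by simp
  have "M *v (a d *s V d + (\<Sum>c\<in>S. a c *s V c)) - d *s (a d *s V d + (\<Sum>c\<in>S. a c *s V c))
      = (\<Sum>c\<in>S. (a c * (c - d)) *s V c)"
  proof -
    have "M *v (\<Sum>c\<in>S. a c *s V c) = (\<Sum>c\<in>S. (a c * c) *s V c)"
      using insert.prems(1)
      by (simp add: vec.linear_sum[OF matrix_vector_mul_linear_gen]
          matrix_vector_mult_scaleR vector_scalar_commute mult.commute vector_smult_assoc)
    moreover have "M *v V d = d *s V d" using insert.prems(1) by simp
    ultimately show ?thesis
      by (simp add: matrix_vector_right_distrib vector_scalar_commute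
          vec.scale_right_distrib vec.scale_sum_right vector_smult_assoc algebra_simps
          vec.scale_left_diff_distrib sum_subtractf)
  qed
  then have "(\<Sum>c\<in>S. (a c * (c - d)) *s V c) = 0"
    using rel by simp
  then have "\<forall>c\<in>S. a c * (c - d) = 0"
    using insert.prems(1) by (intro insert.IH) auto
  then have aS: "\<forall>c\<in>S. a c = 0"
    using insert.hyps by auto
  then have "a d *s V d = 0" using rel by simp
  then have "a d = 0" using insert.prems(1)[of d] by simp
  then show ?case using aS by simp
qed simp

text \<open>
  Finiteness is what gives the \<open>Max\<close> and \<open>Min\<close> in \<open>spectral_radius\<close> and \<open>min_pos_eigenvalue\<close>
  their meaning; the complex case is the one used for the spectral radius of a real matrix.
\<close>

lemma finite_eigenvalues:
  fixes M :: "'a::field^'n^'n"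
  shows "finite (eigenvalues M)"
proof -
  obtain V where V: "\<And>c. c \<in> eigenvalues M \<Longrightarrow> V c \<noteq> 0 \<and> M *v V c = c *s V c"
    unfolding eigenvalues_def by (atomize_elim, intro choice) auto
  have inj: "inj_on V (eigenvalues M)"
  proof (rule inj_onI)
    fix c d assume cd: "c \<in> eigenvalues M" "d \<in> eigenvalues M" "V c = V d"
    then have "c *s V c = d *s V c" using V by metis
    then show "c = d" using V[OF cd(1)] by simp
  qed
  have "vec.independent (V ` eigenvalues M)"
    unfolding vec.dependent_explicit
  proof clarify
    fix U u w assume U: "finite U" "U \<subseteq> V ` eigenvalues M" 
      and sum0: "(\<Sum>v\<in>U. u v *s v) = 0" and w: "w \<in> U" "u w \<noteq> 0"
    obtain S where S: "S \<subseteq> eigenvalues M" "U = V ` S" "finite S"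
      using U finite_subset_image by metis
    have "inj_on V S" using inj S(1) inj_on_subset by blast
    then have "(\<Sum>c\<in>S. u (V c) *s V c) = 0"
      using sum0 by (simp add: S(2) sum.reindex)
    then have "\<forall>c\<in>S. u (V c) = 0"
      using S V by (intro eigenvectors_linear_relation_trivial[where V = V and M = M]) auto
    then show False using w S by auto
  qed
  then have "finite (V ` eigenvalues M)"
    by (rule vec.finiteI_independent)
  then show ?thesis
    using inj finite_imageD by blast
qed

lemma abs_eigenvalue_le_spectral_radius:
  fixes M :: "real^'n^'n"
  assumes "c \<in> eigenvalues M"
  shows "\<bar>c\<bar> \<le> spectral_radius M"
proof -
  obtain v where v: "v \<noteq> 0" "M *v v = c *s v"
    using assms by (auto simp: eigenvalues_def)
  define w :: "complex^'n" where "w = (\<chi> i. complex_of_real (v $ i))"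
  have "w \<noteq> 0"
    using v(1) by (auto simp: w_def vec_eq_iff)
  moreover have "map_matrix complex_of_real M *v w = complex_of_real c *s w"
  proof (rule vec_eq_iff[THEN iffD2], rule allI)
    fix i
    have "(map_matrix complex_of_real M *v w) $ i = complex_of_real ((M *v v) $ i)"
      by (simp add: matrix_vector_mult_def w_def map_matrix_def)
    then show "(map_matrix complex_of_real M *v w) $ i = (complex_of_real c *s w) $ i"
      by (simp add: v(2) w_def)
  qed
  ultimately have "complex_of_real c \<in> eigenvalues (map_matrix complex_of_real M)"
    by (auto simp: eigenvalues_def)
  then have "cmod (complex_of_real c) \<le> spectral_radius M"
    unfolding spectral_radius_def by (intro Max_ge finite_imageI finite_eigenvalues imageI)
  then show ?thesis by simp
qed

section \<open>The block Laplacian\<close>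

text \<open>
  The action of the Kronecker product \<open>M \<otimes> I\<close> on stacked vectors. Its eigenvalues are those of \<open>M\<close>,
  so the extremal argument can be run directly on stacked vectors.
\<close>

definition block_mult :: "real^'n^'n \<Rightarrow> real^'p^'n \<Rightarrow> real^'p^'n" where
  "block_mult M x = (\<chi> i. \<Sum>j\<in>UNIV. M $ i $ j *\<^sub>R x $ j)"

text \<open>
  The stacked vector \<open>1 \<otimes> a\<close>. Vectors of this form are the kernel of the Laplacian of a connected
  graph, and their orthogonal complement consists of the stacked vectors whose blocks sum to zero.
\<close>

definition consensus :: "'a \<Rightarrow> 'a^'n" where
  "consensus a = (\<chi> i. a)"

definition block_mean :: "real^'p^'n \<Rightarrow> real^'p" where
  "block_mean x = (\<Sum>i\<in>UNIV. x $ i) /\<^sub>R real CARD('n)"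

lemma linear_block_mult: "linear (block_mult M)"
  by (rule linearI)
    (simp_all add: block_mult_def vec_eq_iff scaleR_add_right sum.distrib scaleR_sum_right mult.commute
      flip: sum_distrib_left)

lemma consensus_nth [simp]: "consensus a $ i = a"
  by (simp add: consensus_def)

lemma linear_consensus: "linear (consensus :: real^'p \<Rightarrow> real^'p^'n)"
  by (rule linearI) (simp_all add: vec_eq_iff)

lemma inner_consensus_left: "consensus a \<bullet> (x :: real^'p^'n) = a \<bullet> (\<Sum>i\<in>UNIV. x $ i)"
  by (simp add: inner_vec_def[where 'b='n] inner_sum_right)

lemma linear_block_mean: "linear (block_mean :: real^'p^'n \<Rightarrow> real^'p)"
  by (rule linearI) (simp_all add: block_mean_def sum.distrib scaleR_add_right flip: scaleR_sum_right)

lemma block_mean_consensus [simp]: "block_mean (consensus a :: real^'p^'n) = a"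
  by (simp add: block_mean_def sum_constant_scaleR del: sum_constant)

lemma sum_block_minus_mean: "(\<Sum>i\<in>UNIV. (x - consensus (block_mean x)) $ i) = 0"
  by (simp add: block_mean_def sum_subtractf sum_constant_scaleR del: sum_constant)

lemma block_mult_selfadjoint:
  assumes "\<And>i j. M $ i $ j = M $ j $ i"
  shows "block_mult M x \<bullet> y = x \<bullet> block_mult M y"
proof -
  have "block_mult M x \<bullet> y = (\<Sum>i\<in>UNIV. \<Sum>j\<in>UNIV. M $ i $ j * (x $ j \<bullet> y $ i))"
    by (simp add: inner_vec_def[where 'b='a] block_mult_def inner_sum_left)
  also have "\<dots> = (\<Sum>i\<in>UNIV. \<Sum>j\<in>UNIV. M $ i $ j * (x $ i \<bullet> y $ j))"
    by (subst sum.swap) (simp add: assms)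
  also have "\<dots> = x \<bullet> block_mult M y"
    by (simp add: inner_vec_def[where 'b='a] block_mult_def inner_sum_right)
  finally show ?thesis .
qed

lemma block_eigenvalue_is_eigenvalue:
  assumes "block_mult M u = \<mu> *\<^sub>R u" "u \<noteq> 0"
  shows "\<mu> \<in> eigenvalues M"
proof -
  obtain i c where ic: "u $ i $ c \<noteq> 0"
    using assms(2) by (auto simp: vec_eq_iff)
  define v where "v = (\<chi> j. u $ j $ c)"
  have "v \<noteq> 0" using ic by (auto simp: v_def vec_eq_iff)
  moreover have "M *v v = \<mu> *s v"
  proof (rule vec_eq_iff[THEN iffD2], rule allI)
    fix j
    have "(M *v v) $ j = block_mult M u $ j $ c"
      by (simp add: block_mult_def matrix_vector_mult_def v_def)
    then show "(M *v v) $ j = (\<mu> *s v) $ j"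
      by (simp add: assms(1) v_def)
  qed
  ultimately show ?thesis by (auto simp: eigenvalues_def)
qed

text \<open>
  The row sums of a Laplacian vanish, so it acts through differences of blocks.
\<close>

lemma block_laplacian_nth:
  "block_mult (laplacian A) x $ i = (\<Sum>j\<in>UNIV. A $ i $ j *\<^sub>R (x $ i - x $ j))"
proof -
  have "block_mult (laplacian A) x $ i
      = (\<Sum>j\<in>UNIV. (if i = j then (\<Sum>k\<in>UNIV. A $ i $ k) *\<^sub>R x $ j else 0)) - (\<Sum>j\<in>UNIV. A $ i $ j *\<^sub>R x $ j)"
    unfolding sum_subtractf[symmetric]
    by (auto simp: block_mult_def laplacian_def scaleR_left_diff_distrib intro!: sum.cong)
  then show ?thesis
    by (simp add: scaleR_right_diff_distrib sum_subtractf scaleR_sum_left)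
qed

lemma block_laplacian_consensus [simp]: "block_mult (laplacian A) (consensus a) = 0"
  by (simp add: vec_eq_iff block_laplacian_nth)

lemma block_laplacian_selfadjoint:
  assumes "weighted_adjacency A"
  shows "block_mult (laplacian A) x \<bullet> y = x \<bullet> block_mult (laplacian A) y"
  using assms by (intro block_mult_selfadjoint) (auto simp: laplacian_def weighted_adjacency_def)

lemma sum_block_laplacian:
  assumes "weighted_adjacency A"
  shows "(\<Sum>i\<in>UNIV. block_mult (laplacian A) x $ i) = 0" (is "?s = 0")
proof -
  have "?s \<bullet> ?s = consensus ?s \<bullet> block_mult (laplacian A) x"
    by (simp only: inner_consensus_left)
  also have "\<dots> = block_mult (laplacian A) (consensus ?s) \<bullet> x"
    by (simp only: block_laplacian_selfadjoint[OF assms])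
  finally show ?thesis by simp
qed

lemma block_laplacian_quadratic_form:
  assumes "weighted_adjacency A"
  shows "block_mult (laplacian A) x \<bullet> x = (\<Sum>i\<in>UNIV. \<Sum>j\<in>UNIV. A $ i $ j * (norm (x $ i - x $ j))\<^sup>2) / 2"
proof -
  have sym: "A $ i $ j = A $ j $ i" for i j
    using assms by (simp add: weighted_adjacency_def)
  have *: "block_mult (laplacian A) x \<bullet> x = (\<Sum>i\<in>UNIV. \<Sum>j\<in>UNIV. A $ i $ j * ((x $ i - x $ j) \<bullet> x $ i))"
    by (simp add: inner_vec_def[where 'b='a] block_laplacian_nth inner_sum_left)
  have **: "block_mult (laplacian A) x \<bullet> x = (\<Sum>i\<in>UNIV. \<Sum>j\<in>UNIV. A $ i $ j * ((x $ j - x $ i) \<bullet> x $ j))"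
    unfolding * by (subst sum.swap) (simp add: sym)
  have "2 * (block_mult (laplacian A) x \<bullet> x)
      = (\<Sum>i\<in>UNIV. \<Sum>j\<in>UNIV. A $ i $ j * ((x $ i - x $ j) \<bullet> x $ i) + A $ i $ j * ((x $ j - x $ i) \<bullet> x $ j))"
    unfolding sum.distrib using * ** by simp
  also have "\<dots> = (\<Sum>i\<in>UNIV. \<Sum>j\<in>UNIV. A $ i $ j * (norm (x $ i - x $ j))\<^sup>2)"
    by (intro sum.cong refl)
      (simp add: power2_norm_eq_inner inner_simps inner_commute algebra_simps)
  finally show ?thesis by simp
qed

lemma block_laplacian_nonneg:
  assumes "weighted_adjacency A"
  shows "0 \<le> block_mult (laplacian A) x \<bullet> x"
  using assms
  by (auto simp: block_laplacian_quadratic_form[OF assms] weighted_adjacency_def intro!: sum_nonneg)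

text \<open>
  The quadratic form is a sum of nonnegative edge terms. When it vanishes, the blocks agree along
  every edge, hence along every path.
\<close>

lemma block_laplacian_kernel:
  assumes A: "weighted_adjacency A" "connected_graph A"
    and 0: "block_mult (laplacian A) x \<bullet> x = 0"
  shows "x = consensus (x $ i)"
proof -
  have A0: "A $ i $ j \<ge> 0" for i j
    using A by (simp add: weighted_adjacency_def)
  have "(\<Sum>i\<in>UNIV. \<Sum>j\<in>UNIV. A $ i $ j * (norm (x $ i - x $ j))\<^sup>2) = 0"
    using 0 by (simp add: block_laplacian_quadratic_form[OF A(1)])
  then have edge: "A $ i $ j * (norm (x $ i - x $ j))\<^sup>2 = 0" for i j
    by (simp add: sum_nonneg_eq_0_iff sum_nonneg A0)
  have "x $ i = x $ j" if "(i, j) \<in> (edge_rel A)\<^sup>*" for i j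
    using that
  proof (induction rule: rtrancl_induct)
    case (step j k)
    then show ?case using edge[of j k] by (auto simp: edge_rel_def)
  qed simp
  then show ?thesis
    using A(2) by (simp add: connected_graph_def vec_eq_iff[where 'b='a])
qed

text \<open>
  The least Rayleigh quotient on the complement of the kernel is an eigenvalue, and it is positive
  since the form has no zero there apart from the zero vector. So positive eigenvalues exist, and
  the smallest of them is at most this quotient. Two vertices are needed for the complement to be
  nontrivial.
\<close>

lemma block_laplacian_min_pos_eigenvalue:
  fixes A :: "real^'n^'n" and z :: "real^'p^'n"
  assumes A: "weighted_adjacency A" "connected_graph A" and n: "CARD('n) \<ge> 2"
  shows "min_pos_eigenvalue (laplacian A) > 0"
    and "min_pos_eigenvalue (laplacian A) \<in> eigenvalues (laplacian A)"
    and "(\<Sum>i\<in>UNIV. z $ i) = 0 \<Longrightarrow>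
      min_pos_eigenvalue (laplacian A) * (z \<bullet> z) \<le> block_mult (laplacian A) z \<bullet> z"
proof -
  let ?L = "laplacian A" and ?S = "{x :: real^'p^'n. (\<Sum>i\<in>UNIV. x $ i) = 0}"
  have "\<not> is_singleton (UNIV :: 'n set)"
    using n by (auto simp: is_singleton_altdef)
  then obtain i j :: 'n where ij: "i \<noteq> j"
    by (metis UNIV_I is_singletonI' empty_iff)
  define s :: "real^'p^'n" where "s = axis i 1 - axis j 1"
  have s: "s \<in> ?S" "s \<noteq> 0"
  proof -
    show "s \<in> ?S" by (simp add: s_def sum_subtractf axis_def)
    have "s $ i = 1" using ij by (simp add: s_def axis_def)
    then show "s \<noteq> 0" by auto
  qed
  have "subspace ?S"
    by (auto simp: subspace_def sum.distrib simp flip: scaleR_sum_right)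
  then obtain u \<mu> where u: "u \<in> ?S" "u \<noteq> 0" "block_mult ?L u = \<mu> *\<^sub>R u"
    and rayleigh: "\<And>x. x \<in> ?S \<Longrightarrow> \<mu> * (x \<bullet> x) \<le> block_mult ?L x \<bullet> x"
    using sum_block_laplacian[OF A(1)] s
    by (elim min_eigenvector_in_invariant_subspace[OF linear_block_mult block_laplacian_selfadjoint[OF A(1)],
          of ?S s])
      blast+
  have eig: "\<mu> \<in> eigenvalues ?L"
    using block_eigenvalue_is_eigenvalue u by blast
  have "\<mu> * (u \<bullet> u) = block_mult ?L u \<bullet> u"
    using u(3) by simp
  moreover have "block_mult ?L u \<bullet> u \<noteq> 0"
  proof
    assume "block_mult ?L u \<bullet> u = 0"
    then have c: "u = consensus (u $ i)" by (rule block_laplacian_kernel[OF A])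
    then have "u = consensus (block_mean u)" by (metis block_mean_consensus)
    moreover have "block_mean u = 0" using u(1) by (simp add: block_mean_def)
    ultimately show False using u(2) linear_0[OF linear_consensus] by metis
  qed
  ultimately have "\<mu> * (u \<bullet> u) > 0"
    using block_laplacian_nonneg[OF A(1), of u] by simp
  then have pos: "\<mu> > 0"
    using inner_ge_zero[of u] by (auto simp: zero_less_mult_iff simp del: inner_ge_zero)
  have fin: "finite {c \<in> eigenvalues ?L. c > 0}"
    by (intro finite_Collect_conjI disjI1) (simp add: finite_eigenvalues)
  have "min_pos_eigenvalue ?L \<in> {c \<in> eigenvalues ?L. c > 0}"
    unfolding min_pos_eigenvalue_def using eig pos by (intro Min_in[OF fin]) auto
  then show "min_pos_eigenvalue ?L > 0" "min_pos_eigenvalue ?L \<in> eigenvalues ?L"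
    by auto
  have le: "min_pos_eigenvalue ?L \<le> \<mu>"
    unfolding min_pos_eigenvalue_def using eig pos by (intro Min_le[OF fin]) auto
  show "min_pos_eigenvalue ?L * (z \<bullet> z) \<le> block_mult ?L z \<bullet> z" if "(\<Sum>i\<in>UNIV. z $ i) = 0"
    using mult_right_mono[OF le, of "z \<bullet> z"] rayleigh[of z] that by simp
qed

text \<open>
  The largest Rayleigh quotient is an eigenvalue too.
\<close>

lemma block_mult_le_spectral_radius:
  fixes M :: "real^'n^'n" and x :: "real^'p^'n"
  assumes sym: "\<And>i j. M $ i $ j = M $ j $ i"
  shows "block_mult M x \<bullet> x \<le> spectral_radius M * (x \<bullet> x)"
proof (cases "x = 0")
  case False
  have lin: "linear (\<lambda>x :: real^'p^'n. - block_mult M x)"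
    using linear_block_mult by (rule linear_compose_neg)
  have adj: "(- block_mult M x) \<bullet> y = x \<bullet> (- block_mult M y)" for x y :: "real^'p^'n"
    using block_mult_selfadjoint[OF sym] by simp
  obtain u :: "real^'p^'n" and \<mu> where u: "u \<noteq> 0" "- block_mult M u = \<mu> *\<^sub>R u"
    and rayleigh: "\<mu> * (x \<bullet> x) \<le> (- block_mult M x) \<bullet> x"
    by (rule min_eigenvector_in_invariant_subspace[OF lin adj subspace_UNIV UNIV_I UNIV_I False]) blast
  have "block_mult M u = (- \<mu>) *\<^sub>R u"
    using u(2) by (metis add.inverse_inverse scaleR_minus_left)
  then have "\<bar>- \<mu>\<bar> \<le> spectral_radius M"
    using u(1) by (intro abs_eigenvalue_le_spectral_radius block_eigenvalue_is_eigenvalue)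
  then have "- \<mu> * (x \<bullet> x) \<le> spectral_radius M * (x \<bullet> x)"
    by (intro mult_right_mono) auto
  then show ?thesis using rayleigh by simp
qed (simp add: linear_0[OF linear_block_mult])

text \<open>
  On each eigenspace this says \<open>\<lambda>\<^sup>2 \<le> \<rho> * \<lambda>\<close>. Evaluating the nonnegative form at \<open>q - T q / \<rho>\<close>
  gives it without diagonalizing.
\<close>

lemma norm_sq_image_le_form:
  fixes T :: "'a::real_inner \<Rightarrow> 'a"
  assumes lin: "linear T" and selfadj: "\<And>x y. T x \<bullet> y = x \<bullet> T y"
    and nonneg: "\<And>x. 0 \<le> T x \<bullet> x" and le: "\<And>x. T x \<bullet> x \<le> \<rho> * (x \<bullet> x)" and "\<rho> > 0"
  shows "T q \<bullet> T q \<le> \<rho> * (T q \<bullet> q)"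
proof -
  interpret T: linear T by fact
  define t where "t = 1 / \<rho>"
  have "0 \<le> T (q - t *\<^sub>R T q) \<bullet> (q - t *\<^sub>R T q)" by (rule nonneg)
  also have "\<dots> = T q \<bullet> q - 2 * t * (T q \<bullet> T q) + t\<^sup>2 * (T (T q) \<bullet> T q)"
    using selfadj[of "T q" q]
    by (simp add: T.diff T.scaleR inner_simps inner_commute algebra_simps power2_eq_square)
  also have "\<dots> \<le> T q \<bullet> q - 2 * t * (T q \<bullet> T q) + t\<^sup>2 * (\<rho> * (T q \<bullet> T q))"
    by (intro add_left_mono mult_left_mono le) simp
  also have "\<dots> = T q \<bullet> q - (T q \<bullet> T q) / \<rho>"
    using \<open>\<rho> > 0\<close> by (simp add: t_def power2_eq_square field_simps)
  finally show ?thesis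
    using \<open>\<rho> > 0\<close> by (simp add: field_simps)
qed

text \<open>
  The companion \<open>\<rho>\<^sub>2 * \<lambda> \<le> \<lambda>\<^sup>2\<close>, which holds for the eigenvalue \<open>0\<close> and for all eigenvalues from \<open>\<rho>\<^sub>2\<close>
  on. It is obtained by expanding \<open>\<parallel>T z - \<rho>\<^sub>2 z\<parallel>\<^sup>2 \<ge> 0\<close> for the mean-free part \<open>z\<close> of \<open>x\<close>.
\<close>

lemma block_laplacian_norm_sq_ge_form:
  fixes A :: "real^'n^'n" and x :: "real^'p^'n"
  assumes A: "weighted_adjacency A" "connected_graph A" and n: "CARD('n) \<ge> 2"
  defines "T \<equiv> block_mult (laplacian A) :: real^'p^'n \<Rightarrow> real^'p^'n"
  shows "min_pos_eigenvalue (laplacian A) * (T x \<bullet> x) \<le> T x \<bullet> T x"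
proof -
  interpret T: linear T unfolding T_def by (rule linear_block_mult)
  let ?\<rho>\<^sub>2 = "min_pos_eigenvalue (laplacian A)"
  define z where "z = x - consensus (block_mean x)"
  have Tz: "T z = T x" by (simp add: z_def T.diff) (simp add: T_def)
  have "T x \<bullet> consensus (block_mean x) = 0"
    by (simp add: T_def block_laplacian_selfadjoint[OF A(1)])
  then have Txx: "T x \<bullet> x = T z \<bullet> z"
    by (simp add: Tz) (simp add: z_def inner_simps)
  have "0 \<le> (T z - ?\<rho>\<^sub>2 *\<^sub>R z) \<bullet> (T z - ?\<rho>\<^sub>2 *\<^sub>R z)" by simp
  also have "\<dots> = T z \<bullet> T z - 2 * ?\<rho>\<^sub>2 * (T z \<bullet> z) + ?\<rho>\<^sub>2 * (?\<rho>\<^sub>2 * (z \<bullet> z))"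
    by (simp add: inner_simps inner_commute algebra_simps)
  also have "?\<rho>\<^sub>2 * (?\<rho>\<^sub>2 * (z \<bullet> z)) \<le> ?\<rho>\<^sub>2 * (T z \<bullet> z)"
    unfolding T_def z_def
    using block_laplacian_min_pos_eigenvalue[OF A n]
    by (intro mult_left_mono block_laplacian_min_pos_eigenvalue(3)[OF A n] sum_block_minus_mean)
      (auto intro: less_imp_le)
  finally show ?thesis by (simp add: Txx Tz)
qed

text \<open>
  Adding the projection onto the consensus vectors to the Laplacian makes it injective, hence
  surjective; for a target whose blocks sum to zero the added term vanishes at the preimage.
  This replaces a pseudoinverse of the Laplacian.
\<close>

lemma block_laplacian_range:
  fixes A :: "real^'n^'n" and w :: "real^'p^'n"
  assumes A: "weighted_adjacency A" "connected_graph A" and w: "(\<Sum>i\<in>UNIV. w $ i) = 0"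
  obtains q where "block_mult (laplacian A) q = w"
proof -
  let ?T = "block_mult (laplacian A) :: real^'p^'n \<Rightarrow> real^'p^'n"
  let ?F = "\<lambda>x. ?T x + consensus (block_mean x)"
  have lin: "linear ?F"
    using linear_compose_add[OF linear_block_mult linear_compose[OF linear_block_mean linear_consensus]]
    by (simp add: o_def)
  have mean: "block_mean (?F x) = block_mean x" for x :: "real^'p^'n"
    by (simp add: linear_add[OF linear_block_mean])
      (simp add: block_mean_def sum_block_laplacian[OF A(1)])
  have "inj ?F"
    unfolding linear_injective_0[OF lin]
  proof clarify
    fix x :: "real^'p^'n" assume Fx: "?F x = 0"
    have m: "block_mean x = 0"
      using mean[of x] Fx by (simp add: linear_0[OF linear_block_mean])
    then have "?T x = 0" using Fx by (simp add: linear_0[OF linear_consensus])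
    then have "x = consensus (x $ undefined)"
      by (intro block_laplacian_kernel[OF A]) simp
    then have "x = consensus (block_mean x)" by (metis block_mean_consensus)
    then show "x = 0" using m by (simp add: linear_0[OF linear_consensus])
  qed
  then have "surj ?F" by (intro linear_injective_imp_surjective[OF lin]) auto
  then obtain q where q: "w = ?F q" by blast
  have "block_mean q = 0"
    using mean[of q] w by (simp add: q[symmetric]) (simp add: block_mean_def)
  then have "?T q = w" using q by (simp add: linear_0[OF linear_consensus])
  then show thesis by (rule that)
qed

section \<open>The Lyapunov function\<close>

text \<open>
  Here \<open>y\<close> is the primal error and \<open>T q\<close> is the dual error \<open>w\<close>, so that \<open>T q \<bullet> q\<close> is
  \<open>w \<bullet> T\<^sup>+ w\<close> for the pseudoinverse \<open>T\<^sup>+\<close>. This term cancels the coupling \<open>y \<bullet> w\<close> that the primal step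
  creates, the term with \<open>a / (2 * b)\<close> cancels the coupling \<open>w \<bullet> T y\<close>, and the cross term
  \<open>w \<bullet> y\<close> supplies the decrease in \<open>w\<close>.
\<close>

definition lyapunov :: "real \<Rightarrow> real \<Rightarrow> real \<Rightarrow> ('a::real_inner \<Rightarrow> 'a) \<Rightarrow> 'a \<Rightarrow> 'a \<Rightarrow> real" where
  "lyapunov e a b T y q = e * (y \<bullet> y) + e * (T q \<bullet> q) + a / (2 * b) * (T q \<bullet> T q) + T q \<bullet> y"

lemma inner_ge_weighted:
  fixes u w :: "'a::real_inner"
  assumes "c > 0"
  shows "- (c / 2 * (u \<bullet> u) + (w \<bullet> w) / (2 * c)) \<le> u \<bullet> w"
proof -
  have "0 \<le> (c *\<^sub>R u + w) \<bullet> (c *\<^sub>R u + w) / (2 * c)"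
    using assms by simp
  also have "\<dots> = c / 2 * (u \<bullet> u) + (w \<bullet> w) / (2 * c) + u \<bullet> w"
    using assms by (simp add: inner_simps inner_commute field_simps)
  finally show ?thesis by simp
qed

lemma inner_le_weighted:
  fixes u w :: "'a::real_inner"
  assumes "c > 0"
  shows "u \<bullet> w \<le> c / 2 * (u \<bullet> u) + (w \<bullet> w) / (2 * c)"
  using inner_ge_weighted[OF assms, of "- u" w] by simp

text \<open>
  The condition \<open>b / a \<le> e\<close> is what lets the first and the third term absorb the cross term.
\<close>

lemma lyapunov_lower_bound:
  fixes T :: "'a::real_inner \<Rightarrow> 'a"
  assumes "a > 0" "b > 0" "\<rho> > 0" and e: "b / a \<le> e"
    and T: "T q \<bullet> T q \<le> \<rho> * (T q \<bullet> q)"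
  shows "e * min (1 / \<rho>) (1 / 2) * (y \<bullet> y + T q \<bullet> T q) \<le> lyapunov e a b T y q"
proof -
  have e0: "0 \<le> e" using assms(1,2) e by (meson divide_nonneg_nonneg less_imp_le order_trans)
  have "- (a / (2 * b) * (T q \<bullet> T q) + b / (2 * a) * (y \<bullet> y)) \<le> T q \<bullet> y"
    using inner_ge_weighted[of "a / b" "T q" y] assms(1,2) by (simp add: field_simps)
  moreover have "b / (2 * a) * (y \<bullet> y) \<le> e / 2 * (y \<bullet> y)"
    using e by (intro mult_right_mono) (auto simp: field_simps)
  moreover have "1 / \<rho> * (T q \<bullet> T q) \<le> T q \<bullet> q"
    using T \<open>\<rho> > 0\<close> by (simp add: field_simps)
  then have "e * (1 / \<rho> * (T q \<bullet> T q)) \<le> e * (T q \<bullet> q)"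
    using e0 by (intro mult_left_mono)
  moreover have "e * (min (1 / \<rho>) (1 / 2) * (T q \<bullet> T q)) \<le> e * (1 / \<rho> * (T q \<bullet> T q))"
    using e0 by (intro mult_left_mono mult_right_mono) auto
  moreover have "e * (min (1 / \<rho>) (1 / 2) * (y \<bullet> y)) \<le> e * (1 / 2 * (y \<bullet> y))"
    using e0 by (intro mult_left_mono mult_right_mono) auto
  ultimately show ?thesis
    unfolding lyapunov_def by (simp add: algebra_simps)
qed

lemma lyapunov_upper_bound:
  fixes T :: "'a::real_inner \<Rightarrow> 'a"
  assumes "e \<ge> 0" "\<rho>\<^sub>2 > 0" and T: "\<rho>\<^sub>2 * (T q \<bullet> q) \<le> T q \<bullet> T q"
  shows "lyapunov e a b T y q \<le> max (e / \<rho>\<^sub>2 + a / (2 * b) + 1 / 2) (e + 1 / 2) * (y \<bullet> y + T q \<bullet> T q)"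
proof -
  let ?M = "max (e / \<rho>\<^sub>2 + a / (2 * b) + 1 / 2) (e + 1 / 2)"
  have "T q \<bullet> q \<le> (T q \<bullet> T q) / \<rho>\<^sub>2"
    using T \<open>\<rho>\<^sub>2 > 0\<close> by (simp add: field_simps)
  then have "e * (T q \<bullet> q) \<le> e * ((T q \<bullet> T q) / \<rho>\<^sub>2)"
    using \<open>e \<ge> 0\<close> by (intro mult_left_mono)
  moreover have "T q \<bullet> y \<le> 1 / 2 * (T q \<bullet> T q) + 1 / 2 * (y \<bullet> y)"
    using inner_le_weighted[of 1 "T q" y] by simp
  moreover have "(e / \<rho>\<^sub>2 + a / (2 * b) + 1 / 2) * (T q \<bullet> T q) \<le> ?M * (T q \<bullet> T q)"
    by (intro mult_right_mono) auto
  moreover have "(e + 1 / 2) * (y \<bullet> y) \<le> ?M * (y \<bullet> y)"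
    by (intro mult_right_mono) auto
  ultimately show ?thesis
    unfolding lyapunov_def by (simp add: algebra_simps)
qed

text \<open>
  An expansion of \<open>lyapunov\<close> along \<open>(y, q) + h (d, b y)\<close> into orders of \<open>h\<close>. The new error \<open>y'\<close> need
  not be \<open>y + h d\<close>, because the reference solution moves: after the step the projection onto the
  solution set is a different one. It is enough that the error does not get longer by
  reprojecting and that the change of reference lies in the kernel of \<open>T\<close>, orthogonal to \<open>T q'\<close>.
\<close>

lemma lyapunov_step:
  fixes T :: "'a::real_inner \<Rightarrow> 'a"
  assumes lin: "linear T" and selfadj: "\<And>x y. T x \<bullet> y = x \<bullet> T y"
    and "e \<ge> 0" "b > 0"
    and d: "d = - (a *\<^sub>R T y + b *\<^sub>R T q + g)"
    and q': "q' = q + (h * b) *\<^sub>R y"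
    and y': "y' \<bullet> y' \<le> (y + h *\<^sub>R d) \<bullet> (y + h *\<^sub>R d)" "T q' \<bullet> y' = T q' \<bullet> (y + h *\<^sub>R d)"
  shows "lyapunov e a b T y' q' \<le> lyapunov e a b T y q
      + h * (- 2 * e * (a * (T y \<bullet> y) + g \<bullet> y) + b * (T y \<bullet> y) - b * (T q \<bullet> T q) - T q \<bullet> g)
      + h\<^sup>2 * (e * (d \<bullet> d) + e * b\<^sup>2 * (T y \<bullet> y) + a * b / 2 * (T y \<bullet> T y) + b * (T y \<bullet> d))"
proof -
  interpret T: linear T by fact
  have Tq': "T q' = T q + (h * b) *\<^sub>R T y"
    by (simp add: q' T.add T.scaleR)
  have yd: "y \<bullet> d = - (a * (T y \<bullet> y) + b * (T q \<bullet> y) + g \<bullet> y)"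
    and wd: "T q \<bullet> d = - (a * (T q \<bullet> T y) + b * (T q \<bullet> T q) + T q \<bullet> g)"
    by (simp_all add: d inner_simps inner_commute)
  have 1: "e * (y' \<bullet> y') \<le> e * (y \<bullet> y) + h * (2 * e * (y \<bullet> d)) + h\<^sup>2 * (e * (d \<bullet> d))"
  proof -
    have "e * (y' \<bullet> y') \<le> e * ((y + h *\<^sub>R d) \<bullet> (y + h *\<^sub>R d))"
      using y'(1) \<open>e \<ge> 0\<close> by (rule mult_left_mono)
    then show ?thesis by (simp add: inner_simps inner_commute algebra_simps power2_eq_square)
  qed
  have 2: "e * (T q' \<bullet> q') = e * (T q \<bullet> q) + h * (2 * e * b * (T q \<bullet> y)) + h\<^sup>2 * (e * b\<^sup>2 * (T y \<bullet> y))"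
    using selfadj[of y q]
    by (simp add: Tq') (simp add: q' inner_simps inner_commute algebra_simps power2_eq_square)
  have 3: "a / (2 * b) * (T q' \<bullet> T q')
      = a / (2 * b) * (T q \<bullet> T q) + h * (a * (T q \<bullet> T y)) + h\<^sup>2 * (a * b / 2 * (T y \<bullet> T y))"
    using \<open>b > 0\<close> by (simp add: Tq' inner_simps inner_commute field_simps power2_eq_square)
  have 4: "T q' \<bullet> y' = T q \<bullet> y + h * (b * (T y \<bullet> y) + T q \<bullet> d) + h\<^sup>2 * (b * (T y \<bullet> d))"
    unfolding y'(2) by (simp add: Tq' inner_simps algebra_simps power2_eq_square)
  have "lyapunov e a b T y' q' \<le> lyapunov e a b T y q
      + h * (2 * e * (y \<bullet> d) + 2 * e * b * (T q \<bullet> y) + a * (T q \<bullet> T y) + b * (T y \<bullet> y) + T q \<bullet> d)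
      + h\<^sup>2 * (e * (d \<bullet> d) + e * b\<^sup>2 * (T y \<bullet> y) + a * b / 2 * (T y \<bullet> T y) + b * (T y \<bullet> d))"
    unfolding lyapunov_def using 1 2 3 4 by (simp add: distrib_left)
  also have "2 * e * (y \<bullet> d) + 2 * e * b * (T q \<bullet> y) + a * (T q \<bullet> T y) + b * (T y \<bullet> y) + T q \<bullet> d
      = - 2 * e * (a * (T y \<bullet> y) + g \<bullet> y) + b * (T y \<bullet> y) - b * (T q \<bullet> T q) - T q \<bullet> g"
    unfolding yd wd by (simp add: algebra_simps)
  finally show ?thesis .
qed

text \<open>
  The coercive part contributes \<open>- 2 * e * \<nu>\<^sub>1\<close> times \<open>y \<bullet> y\<close>. Half of it pays for the terms
  \<open>b * (s \<bullet> y)\<close> and \<open>w \<bullet> g\<close> by the choice of \<open>e\<close>, and the other half remains. The variable \<open>s\<close>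
  stands for \<open>T y\<close>.
\<close>

lemma lyapunov_first_order_bound:
  fixes g y w s :: "'a::real_inner"
  assumes "e \<ge> 0" "b > 0"
    and coercive: "\<nu>\<^sub>1 * (y \<bullet> y) \<le> a * (s \<bullet> y) + g \<bullet> y"
    and s: "s \<bullet> y \<le> \<rho> * (y \<bullet> y)" and g: "g \<bullet> g \<le> l\<^sup>2 * (y \<bullet> y)"
    and e: "l\<^sup>2 / (2 * b) + \<rho> * b \<le> e * \<nu>\<^sub>1"
  shows "- 2 * e * (a * (s \<bullet> y) + g \<bullet> y) + b * (s \<bullet> y) - b * (w \<bullet> w) - w \<bullet> g
    \<le> - (min (b / 2) (e * \<nu>\<^sub>1) * (y \<bullet> y + w \<bullet> w))"
proof -
  have "e * (\<nu>\<^sub>1 * (y \<bullet> y)) \<le> e * (a * (s \<bullet> y) + g \<bullet> y)"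
    using coercive \<open>e \<ge> 0\<close> by (rule mult_left_mono)
  moreover have "b * (s \<bullet> y) \<le> b * (\<rho> * (y \<bullet> y))"
    using s \<open>b > 0\<close> by (intro mult_left_mono) auto
  moreover have "- (w \<bullet> g) \<le> b / 2 * (w \<bullet> w) + (g \<bullet> g) / (2 * b)"
    using inner_ge_weighted[OF \<open>b > 0\<close>, of w g] by simp
  moreover have "(g \<bullet> g) / (2 * b) \<le> l\<^sup>2 * (y \<bullet> y) / (2 * b)"
    using g \<open>b > 0\<close> by (intro divide_right_mono) auto
  moreover have "(l\<^sup>2 / (2 * b) + \<rho> * b) * (y \<bullet> y) \<le> e * \<nu>\<^sub>1 * (y \<bullet> y)"
    using e by (intro mult_right_mono) auto
  moreover have "min (b / 2) (e * \<nu>\<^sub>1) * (y \<bullet> y) \<le> e * \<nu>\<^sub>1 * (y \<bullet> y)"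
    "min (b / 2) (e * \<nu>\<^sub>1) * (w \<bullet> w) \<le> b / 2 * (w \<bullet> w)"
    by (intro mult_right_mono; simp)+
  ultimately show ?thesis by (simp add: algebra_simps)
qed

lemma norm_sq_sum3_le:
  fixes u v w :: "'a::real_inner"
  shows "(u + v + w) \<bullet> (u + v + w) \<le> 3 * (u \<bullet> u + v \<bullet> v + w \<bullet> w)"
proof -
  have "0 \<le> (u - v) \<bullet> (u - v) + (v - w) \<bullet> (v - w) + (u - w) \<bullet> (u - w)"
    by (intro add_nonneg_nonneg inner_ge_zero)
  then show ?thesis by (simp add: inner_simps inner_commute)
qed

text \<open>
  The factor with \<open>sqrt 2\<close> resembles a Lipschitz constant of the gradient of \<open>lyapunov\<close>, but with \<open>a\<close>
  where the curvature in the direction of \<open>w\<close> has \<open>a / b\<close>, which can be larger. The resulting term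
  \<open>a * b / 2 * (s \<bullet> s)\<close> is absorbed by \<open>b \<le> e * a\<close>: the entry \<open>4 * e + 1\<close>, multiplied by
  \<open>sqrt 2 / 2\<close>, exceeds the coefficient \<open>e + 1 / 2\<close> of \<open>d \<bullet> d\<close> by more than \<open>e\<close>. Again \<open>s\<close> stands for \<open>T y\<close>.
\<close>

lemma lyapunov_second_order_bound:
  fixes g y w s :: "'a::real_inner"
  assumes "a > 0" "b > 0" "\<rho>\<^sub>2 > 0" and e: "b / a \<le> e"
    and d: "d = - (a *\<^sub>R s + b *\<^sub>R w + g)"
    and s: "\<rho>\<^sub>2 * (s \<bullet> y) \<le> s \<bullet> s" "s \<bullet> s \<le> \<rho>\<^sup>2 * (y \<bullet> y)" and g: "g \<bullet> g \<le> l\<^sup>2 * (y \<bullet> y)"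
  shows "2 * (e * (d \<bullet> d) + e * b\<^sup>2 * (s \<bullet> y) + a * b / 2 * (s \<bullet> s) + b * (s \<bullet> d))
    \<le> sqrt 2 * max (2 * e / \<rho>\<^sub>2 + a + 1) (4 * e + 1)
      * max (b\<^sup>2 * \<rho>\<^sup>2 + 3 * a\<^sup>2 * \<rho>\<^sup>2 + 3 * l\<^sup>2) (3 * b\<^sup>2) * (y \<bullet> y + w \<bullet> w)"
proof -
  have e0: "0 \<le> e" using assms(1,2) e by (meson divide_nonneg_nonneg less_imp_le order_trans)
  define m where "m = max (2 * e / \<rho>\<^sub>2 + a + 1) (4 * e + 1)"
  define M where "M = sqrt 2 * m / 2"
  have m: "2 * e / \<rho>\<^sub>2 + a + 1 \<le> m" "4 * e + 1 \<le> m" by (auto simp: m_def)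
  have m0: "0 \<le> m" using m(2) e0 by simp
  have "7 / 5 \<le> sqrt 2" by (rule real_le_rsqrt) (simp add: power2_eq_square)
  then have "7 / 5 * m / 2 \<le> M"
    unfolding M_def using m0 by (intro divide_right_mono mult_right_mono) auto
  then have Mm: "7 / 10 * m \<le> M" by simp
  have M1: "2 * e + 1 / 2 \<le> M" using Mm m(2) e0 by simp
  have M2: "e / \<rho>\<^sub>2 + 1 / 2 \<le> M"
  proof -
    have "0 \<le> e / \<rho>\<^sub>2" using e0 \<open>\<rho>\<^sub>2 > 0\<close> by simp
    then show ?thesis using Mm m(1) \<open>a > 0\<close> by simp
  qed
  have M0: "0 \<le> M" using M1 e0 by simp
  let ?t = "s \<bullet> s"
  have dd: "d \<bullet> d \<le> 3 * (a\<^sup>2 * ?t + b\<^sup>2 * (w \<bullet> w) + g \<bullet> g)"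
    using norm_sq_sum3_le[of "a *\<^sub>R s" "b *\<^sub>R w" g]
    by (simp add: d power2_eq_square algebra_simps)
  have bsd: "b * (s \<bullet> d) \<le> 1 / 2 * (d \<bullet> d) + 1 / 2 * b\<^sup>2 * ?t"
    using inner_le_weighted[of 1 "b *\<^sub>R s" d] by (simp add: power2_eq_square algebra_simps)
  have "s \<bullet> y \<le> ?t / \<rho>\<^sub>2" using s(1) \<open>\<rho>\<^sub>2 > 0\<close> by (simp add: field_simps)
  then have sy: "e * b\<^sup>2 * (s \<bullet> y) \<le> e * b\<^sup>2 * (?t / \<rho>\<^sub>2)"
    using e0 by (intro mult_left_mono) auto
  have ab: "a * b / 2 * ?t \<le> 1 / 2 * e * a\<^sup>2 * ?t"
  proof (rule mult_right_mono)
    have "b \<le> e * a" using e \<open>a > 0\<close> by (simp add: field_simps)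
    then have "a * b \<le> a * (e * a)" using \<open>a > 0\<close> by (intro mult_left_mono) auto
    then show "a * b / 2 \<le> 1 / 2 * e * a\<^sup>2" by (simp add: power2_eq_square algebra_simps)
  qed simp
  have "e * (d \<bullet> d) + e * b\<^sup>2 * (s \<bullet> y) + a * b / 2 * ?t + b * (s \<bullet> d)
      \<le> (e + 1 / 2) * (d \<bullet> d) + (e / \<rho>\<^sub>2 + 1 / 2) * (b\<^sup>2 * ?t) + 1 / 2 * e * a\<^sup>2 * ?t"
    using bsd sy ab by (simp add: algebra_simps)
  also have "\<dots> \<le> (e + 1 / 2) * (3 * (a\<^sup>2 * ?t + b\<^sup>2 * (w \<bullet> w) + g \<bullet> g)) + M * (b\<^sup>2 * ?t) + 1 / 2 * e * a\<^sup>2 * ?t"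
    using dd e0 M2 by (intro add_mono mult_left_mono mult_right_mono) auto
  also have "\<dots> \<le> 3 * M * (a\<^sup>2 * ?t) + 3 * M * (b\<^sup>2 * (w \<bullet> w)) + 3 * M * (g \<bullet> g) + M * (b\<^sup>2 * ?t)"
  proof -
    have "(2 * e + 1 / 2) * (a\<^sup>2 * ?t) \<le> M * (a\<^sup>2 * ?t)"
      "(e + 1 / 2) * (b\<^sup>2 * (w \<bullet> w)) \<le> M * (b\<^sup>2 * (w \<bullet> w))" "(e + 1 / 2) * (g \<bullet> g) \<le> M * (g \<bullet> g)"
      using M1 e0 by (intro mult_right_mono; simp)+
    moreover have "0 \<le> e * (a\<^sup>2 * ?t)" using e0 by simp
    ultimately show ?thesis by (simp add: algebra_simps)
  qed
  also have "\<dots> = M * ((3 * a\<^sup>2 + b\<^sup>2) * ?t + 3 * (g \<bullet> g) + 3 * b\<^sup>2 * (w \<bullet> w))"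
    by (simp add: algebra_simps)
  also have "\<dots> \<le> M * ((3 * a\<^sup>2 + b\<^sup>2) * (\<rho>\<^sup>2 * (y \<bullet> y)) + 3 * (l\<^sup>2 * (y \<bullet> y)) + 3 * b\<^sup>2 * (w \<bullet> w))"
    using s(2) g M0 by (intro mult_left_mono add_mono) auto
  also have "\<dots> = M * ((b\<^sup>2 * \<rho>\<^sup>2 + 3 * a\<^sup>2 * \<rho>\<^sup>2 + 3 * l\<^sup>2) * (y \<bullet> y) + 3 * b\<^sup>2 * (w \<bullet> w))"
    by (simp add: algebra_simps)
  also have "\<dots> \<le> M * (max (b\<^sup>2 * \<rho>\<^sup>2 + 3 * a\<^sup>2 * \<rho>\<^sup>2 + 3 * l\<^sup>2) (3 * b\<^sup>2) * (y \<bullet> y)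
      + max (b\<^sup>2 * \<rho>\<^sup>2 + 3 * a\<^sup>2 * \<rho>\<^sup>2 + 3 * l\<^sup>2) (3 * b\<^sup>2) * (w \<bullet> w))"
    using M0 by (intro mult_left_mono add_mono mult_right_mono) auto
  finally show ?thesis
    by (simp add: M_def m_def[symmetric] distrib_left mult.assoc)
qed

text \<open>
  Taking square roots halves the exponent of decay because \<open>1 - 2 * r \<le> (1 - r)\<^sup>2\<close>. If \<open>1 - 2 * r\<close> is
  negative, a nonnegative \<open>V\<close> can satisfy the contraction only by vanishing.
\<close>

lemma norm_decay_of_square_contraction:
  fixes D V :: "nat \<Rightarrow> real"
  assumes c: "c > 0" and D: "\<And>k. 0 \<le> D k" and DV: "\<And>k. c * (D k)\<^sup>2 \<le> V k"
    and V: "\<And>k. V (Suc k) \<le> (1 - 2 * r) * V k"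
  shows "\<exists>C\<ge>0. \<forall>k. D k \<le> C * (1 - r) ^ k"
proof -
  have V0: "0 \<le> V k" for k
    using DV[of k] c by (meson mult_nonneg_nonneg less_imp_le order_trans zero_le_power2)
  show ?thesis
  proof (cases "0 \<le> 1 - 2 * r")
    case True
    have r: "1 - r \<ge> 0" using True by simp
    have Vk: "V k \<le> V 0 * ((1 - r) ^ k)\<^sup>2" for k
    proof (induction k)
      case (Suc k)
      have "V (Suc k) \<le> (1 - 2 * r) * V k" by (rule V)
      also have "\<dots> \<le> (1 - r)\<^sup>2 * V k"
        using V0[of k] by (intro mult_right_mono) (auto simp: power2_eq_square algebra_simps)
      also have "\<dots> \<le> (1 - r)\<^sup>2 * (V 0 * ((1 - r) ^ k)\<^sup>2)"
        by (intro mult_left_mono Suc) simp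
      finally show ?case by (simp add: power_mult_distrib mult.assoc mult.left_commute)
    qed simp
    have "D k \<le> sqrt (V 0 / c) * (1 - r) ^ k" for k
    proof (rule power2_le_imp_le)
      have "c * (D k)\<^sup>2 \<le> V 0 * ((1 - r) ^ k)\<^sup>2"
        using DV Vk by (rule order_trans)
      then show "(D k)\<^sup>2 \<le> (sqrt (V 0 / c) * (1 - r) ^ k)\<^sup>2"
        using c V0[of 0] by (simp add: power_mult_distrib field_simps)
    qed (use r c V0[of 0] in simp)
    moreover have "0 \<le> sqrt (V 0 / c)" using c V0[of 0] by simp
    ultimately show ?thesis by blast
  next
    case False
    have "V k = 0" for k
    proof (rule ccontr)
      assume "V k \<noteq> 0"
      then have "(1 - 2 * r) * V k < 0"
        using V0[of k] False by (intro mult_neg_pos) auto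
      then show False using V[of k] V0[of "Suc k"] by simp
    qed
    then have "D k = 0" for k
      using DV[of k] c by (simp add: mult_le_0_iff)
    then show ?thesis by (intro exI[of _ 0]) simp
  qed
qed

section \<open>Projection onto the consensus solutions\<close>

text \<open>
  Pythagoras for the splitting into mean and mean-free part. It shows that projecting a
  stacked vector onto consensus solutions amounts to projecting its block mean.
\<close>

lemma norm_sq_minus_consensus:
  fixes x :: "real^'p^'n"
  shows "(x - consensus a) \<bullet> (x - consensus a)
    = (x - consensus (block_mean x)) \<bullet> (x - consensus (block_mean x))
      + real CARD('n) * ((block_mean x - a) \<bullet> (block_mean x - a))"
proof -
  define z where "z = x - consensus (block_mean x)"
  define u where "u = block_mean x - a"
  have split: "x - consensus a = z + consensus u"
    by (simp add: z_def u_def linear_diff[OF linear_consensus])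
  have "consensus u \<bullet> z = 0"
    unfolding inner_consensus_left z_def sum_block_minus_mean by simp
  moreover have "consensus u \<bullet> (consensus u :: real^'p^'n) = real CARD('n) * (u \<bullet> u)"
    by (simp add: inner_vec_def[where 'b='n])
  ultimately show ?thesis
    unfolding split z_def[symmetric] u_def[symmetric]
    by (simp add: inner_add_left inner_add_right inner_commute)
qed

lemma closed_convex_consensus_image:
  fixes X :: "(real^'p) set"
  assumes "closed X" "convex X"
  shows "closed (consensus ` X :: (real^'p^'n) set)" "convex (consensus ` X :: (real^'p^'n) set)"
proof -
  have "inj (consensus :: real^'p \<Rightarrow> real^'p^'n)"
    by (rule injI) (simp add: vec_eq_iff)
  then show "closed (consensus ` X :: (real^'p^'n) set)"
    using assms(1) linear_consensus closed_injective_linear_image by blast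
  show "convex (consensus ` X :: (real^'p^'n) set)"
    using assms(2) linear_consensus convex_linear_image by blast
qed

lemma closest_point_consensus_image:
  fixes X :: "(real^'p) set" and x :: "real^'p^'n"
  assumes X: "closed X" "convex X" "X \<noteq> {}"
  shows "closest_point (consensus ` X) x = consensus (closest_point X (block_mean x))"
proof -
  let ?p = "closest_point X (block_mean x)"
  have "dist x (consensus ?p) \<le> dist x (consensus a)" if "a \<in> X" for a
  proof -
    have "norm (block_mean x - ?p) \<le> norm (block_mean x - a)"
      using closest_point_le[OF X(1) that, of "block_mean x"] by (simp add: dist_norm)
    then have "(block_mean x - ?p) \<bullet> (block_mean x - ?p) \<le> (block_mean x - a) \<bullet> (block_mean x - a)"
      by (simp add: norm_le)
    then have "real CARD('n) * ((block_mean x - ?p) \<bullet> (block_mean x - ?p))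
        \<le> real CARD('n) * ((block_mean x - a) \<bullet> (block_mean x - a))"
      by (rule mult_left_mono) simp
    then have "(x - consensus ?p) \<bullet> (x - consensus ?p) \<le> (x - consensus a) \<bullet> (x - consensus a)"
      using norm_sq_minus_consensus[of x ?p] norm_sq_minus_consensus[of x a] by linarith
    then show ?thesis
      by (simp add: dist_norm norm_le)
  qed
  then show ?thesis
    using closed_convex_consensus_image[OF X(1,2)] closest_point_in_set[OF X(1,3)]
    by (intro closest_point_unique[symmetric]) auto
qed

section \<open>Coercivity of the linearly coupled gradient field\<close>

text \<open>
  Split the error into its mean-free part \<open>z\<close> and the error \<open>u\<close> of the mean. Along \<open>u\<close> the
  gradients at the mean act together, and the secant inequality for their sum gives \<open>\<nu> * (u \<bullet> u)\<close>.
  Everything else involves \<open>z\<close> and is controlled by the Lipschitz constant, at the expense of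
  half of that term and a multiple of \<open>z \<bullet> z\<close>, for which the Laplacian pays.
\<close>

lemma laplacian_plus_gradient_coercive:
  fixes A :: "real^'n^'n" and x :: "real^'p^'n" and G :: "'n \<Rightarrow> real^'p \<Rightarrow> real^'p"
  assumes A: "weighted_adjacency A" "connected_graph A" and n: "CARD('n) \<ge> 2"
    and lip: "\<And>i a b. norm (G i a - G i b) \<le> l * norm (a - b)" and "\<nu> > 0" "\<alpha> \<ge> 0"
    and secant: "\<nu> * (norm (block_mean x - p))\<^sup>2
      \<le> ((\<Sum>i\<in>UNIV. G i (block_mean x)) - (\<Sum>i\<in>UNIV. G i p)) \<bullet> (block_mean x - p)"
  defines "N \<equiv> real CARD('n)" and "\<rho>\<^sub>2 \<equiv> min_pos_eigenvalue (laplacian A)" and "y \<equiv> x - consensus p"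
  shows "min (\<nu> / (2 * N)) (\<alpha> * \<rho>\<^sub>2 - (2 * N * l\<^sup>2 + \<nu> * l) / \<nu>) * (y \<bullet> y)
    \<le> \<alpha> * (block_mult (laplacian A) y \<bullet> y) + (\<chi> i. G i (x $ i) - G i p) \<bullet> y"
proof -
  let ?T = "block_mult (laplacian A) :: real^'p^'n \<Rightarrow> real^'p^'n"
  define m where "m = block_mean x"
  define u where "u = m - p"
  define z where "z = x - consensus m"
  define \<kappa> where "\<kappa> = (2 * N * l\<^sup>2 + \<nu> * l) / \<nu>"
  have N: "N > 0" using n by (simp add: N_def)
  have yzu: "y = z + consensus u"
    by (simp add: y_def z_def u_def linear_diff[OF linear_consensus])
  have yi: "y $ i = z $ i + u" for i by (simp add: yzu)
  have sz: "(\<Sum>i\<in>UNIV. z $ i) = 0"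
    unfolding z_def m_def by (rule sum_block_minus_mean)
  have yy: "y \<bullet> y = z \<bullet> z + N * (u \<bullet> u)"
    unfolding y_def z_def u_def m_def N_def by (rule norm_sq_minus_consensus)
  have zz: "z \<bullet> z = (\<Sum>i\<in>UNIV. (norm (z $ i))\<^sup>2)"
    by (simp add: inner_vec_def[where 'b='n] power2_norm_eq_inner)
  have "?T y \<bullet> y = ?T z \<bullet> z"
  proof -
    have "?T y = ?T z" by (simp add: yzu linear_add[OF linear_block_mult])
    moreover have "?T z \<bullet> consensus u = 0"
      by (simp add: block_laplacian_selfadjoint[OF A(1)])
    ultimately show ?thesis by (simp add: yzu inner_add_right)
  qed
  also have "\<rho>\<^sub>2 * (z \<bullet> z) \<le> \<dots>"
    unfolding \<rho>\<^sub>2_def by (rule block_laplacian_min_pos_eigenvalue(3)[OF A n sz])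
  finally have Ty: "\<alpha> * (\<rho>\<^sub>2 * (z \<bullet> z)) \<le> \<alpha> * (?T y \<bullet> y)"
    using \<open>\<alpha> \<ge> 0\<close> by (intro mult_left_mono)
  \<comment> \<open>The four parts of this scalar product pair the two legs \<open>p\<close> to \<open>m\<close> and \<open>m\<close> to \<open>x $ i\<close> of the
    gradient difference with \<open>u\<close> and \<open>z $ i\<close>; only the first is not small with \<open>z $ i\<close>, and the two mixed
    ones are split by Young's inequality, with a weight that makes all blocks together use
    \<open>\<nu> / 2 * (u \<bullet> u)\<close>.\<close>
  have block: "(G i m - G i p) \<bullet> u - \<nu> / (2 * N) * (u \<bullet> u) - \<kappa> * (norm (z $ i))\<^sup>2
      \<le> (G i (x $ i) - G i p) \<bullet> y $ i" for i
  proof -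
    have xm: "x $ i - m = z $ i" by (simp add: z_def)
    have CS: "- (l * norm (a - b) * norm c) \<le> (G i a - G i b) \<bullet> c" for a b c
    proof -
      have "\<bar>(G i a - G i b) \<bullet> c\<bar> \<le> norm (G i a - G i b) * norm c"
        by (rule Cauchy_Schwarz_ineq2)
      also have "\<dots> \<le> l * norm (a - b) * norm c"
        by (intro mult_right_mono lip) simp
      finally show ?thesis by simp
    qed
    have "(G i (x $ i) - G i p) \<bullet> y $ i = (G i m - G i p) \<bullet> u + (G i (x $ i) - G i m) \<bullet> u
        + (G i (x $ i) - G i m) \<bullet> z $ i + (G i m - G i p) \<bullet> z $ i"
      by (simp add: yi inner_simps algebra_simps)
    moreover have "2 * l * norm (z $ i) * norm u \<le> \<nu> / (2 * N) * (u \<bullet> u) + 2 * N * l\<^sup>2 / \<nu> * (norm (z $ i))\<^sup>2"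
    proof -
      define c where "c = \<nu> / N"
      have c: "c > 0" using \<open>\<nu> > 0\<close> N by (simp add: c_def)
      have "0 \<le> (c * norm u - 2 * l * norm (z $ i))\<^sup>2 / (2 * c)"
        using c by simp
      also have "\<dots> = c / 2 * (norm u)\<^sup>2 + 2 * l\<^sup>2 / c * (norm (z $ i))\<^sup>2 - 2 * l * norm (z $ i) * norm u"
        using c by (simp add: field_simps power2_eq_square)
      finally show ?thesis
        using N \<open>\<nu> > 0\<close> by (simp add: c_def power2_norm_eq_inner mult.commute mult.left_commute)
    qed
    moreover have "\<kappa> * (norm (z $ i))\<^sup>2 = 2 * N * l\<^sup>2 / \<nu> * (norm (z $ i))\<^sup>2 + l * norm (z $ i) * norm (z $ i)"
      using \<open>\<nu> > 0\<close> by (simp add: \<kappa>_def add_divide_distrib algebra_simps power2_eq_square)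
    ultimately show ?thesis
      using CS[of "x $ i" m u] CS[of "x $ i" m "z $ i"] CS[of m p "z $ i"]
      unfolding xm u_def[symmetric] by (simp add: algebra_simps)
  qed
  have "\<nu> * (u \<bullet> u) - \<nu> / 2 * (u \<bullet> u) - \<kappa> * (z \<bullet> z)
      \<le> ((\<Sum>i\<in>UNIV. G i m) - (\<Sum>i\<in>UNIV. G i p)) \<bullet> u - \<nu> / 2 * (u \<bullet> u) - \<kappa> * (z \<bullet> z)"
    using secant unfolding m_def[symmetric] u_def[symmetric] by (simp add: power2_norm_eq_inner)
  also have "\<dots> = (\<Sum>i\<in>UNIV. (G i m - G i p) \<bullet> u - \<nu> / (2 * N) * (u \<bullet> u) - \<kappa> * (norm (z $ i))\<^sup>2)"
    using N by (simp add: sum_subtractf zz sum_distrib_left inner_sum_left inner_diff_left N_def)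
  also have "\<dots> \<le> (\<Sum>i\<in>UNIV. (G i (x $ i) - G i p) \<bullet> y $ i)"
    by (intro sum_mono block)
  also have "\<dots> = (\<chi> i. G i (x $ i) - G i p) \<bullet> y"
    by (simp add: inner_vec_def[where 'b='n])
  finally have g: "\<nu> / 2 * (u \<bullet> u) - \<kappa> * (z \<bullet> z) \<le> (\<chi> i. G i (x $ i) - G i p) \<bullet> y" by simp
  let ?\<nu>\<^sub>1 = "min (\<nu> / (2 * N)) (\<alpha> * \<rho>\<^sub>2 - \<kappa>)"
  have "?\<nu>\<^sub>1 * (z \<bullet> z) \<le> (\<alpha> * \<rho>\<^sub>2 - \<kappa>) * (z \<bullet> z)" by (intro mult_right_mono) auto
  moreover have "?\<nu>\<^sub>1 * (N * (u \<bullet> u)) \<le> \<nu> / (2 * N) * (N * (u \<bullet> u))"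
    using N by (intro mult_right_mono) auto
  moreover have "\<nu> / (2 * N) * (N * (u \<bullet> u)) = \<nu> / 2 * (u \<bullet> u)"
    using N by simp
  ultimately have "?\<nu>\<^sub>1 * (y \<bullet> y) \<le> \<alpha> * (?T y \<bullet> y) + (\<chi> i. G i (x $ i) - G i p) \<bullet> y"
    unfolding yy using Ty g by (simp add: algebra_simps)
  then show ?thesis by (simp add: \<kappa>_def)
qed

section \<open>Linear convergence\<close>

theorem theorem2:
  fixes A :: "real ^ 'n ^ 'n"
    and L :: "real ^ 'n ^ 'n"
    and fi :: "'n \<Rightarrow> real ^ 'p \<Rightarrow> real"
    and f :: "real ^ 'p \<Rightarrow> real"
    and ft :: "real ^ 'p ^ 'n \<Rightarrow> real"
    and X :: "(real ^ 'p) set"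
    and XX :: "(real ^ 'p ^ 'n) set"
    and Lfi :: "'n \<Rightarrow> real"
    and n Lf \<nu> \<alpha> \<beta> h \<rho> \<rho>\<^sub>2 \<nu>\<^sub>1 \<epsilon>\<^sub>1 \<epsilon>\<^sub>2 \<epsilon>\<^sub>3 \<epsilon>\<^sub>4 \<epsilon>\<^sub>5 \<eta> :: real
    and x v :: "nat \<Rightarrow> real ^ 'p ^ 'n"
  assumes n_ge_2: "CARD('n) \<ge> 2"
    and n: "n = real CARD('n)"
    and graph: "weighted_adjacency A" "connected_graph A"
    and L: "L = laplacian A"
    and \<rho>: "\<rho> = spectral_radius L"
    and \<rho>\<^sub>2: "\<rho>\<^sub>2 = min_pos_eigenvalue L"
    and diff: "\<And>i a. fi i differentiable (at a)"
    and f: "f = (\<lambda>y. \<Sum>i\<in>UNIV. fi i y)"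
    and ft: "ft = (\<lambda>y. \<Sum>i\<in>UNIV. fi i (y $ i))"
    and X: "X = global_minimizers f"
    and XX: "XX = (\<lambda>y. \<chi> i. y) ` X"
    and X_nonempty: "X \<noteq> {}"
    and X_convex: "convex X"
    and Lfi_pos: "\<And>i. Lfi i > 0"
    and lipschitz: "\<And>i a b. norm (gradient (fi i) a - gradient (fi i) b) \<le> Lfi i * norm (a - b)"
    and Lf: "Lf = Max (range Lfi)"
    and \<nu>_pos: "\<nu> > 0"
    and rsi: "restricted_secant f \<nu>"
    and singleton: "is_singleton (gradient ft ` XX)"
    and \<alpha>: "\<alpha> > (2 * n * Lf\<^sup>2 + \<nu> * Lf) / (\<nu> * \<rho>\<^sub>2)"
    and \<beta>: "\<beta> > 0"
    and \<nu>\<^sub>1: "\<nu>\<^sub>1 = min (\<nu> / (2 * n)) (\<alpha> * \<rho>\<^sub>2 - (2 * n * Lf\<^sup>2 + \<nu> * Lf) / \<nu>)"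
    and \<epsilon>\<^sub>1: "\<epsilon>\<^sub>1 = max (1 / \<nu>\<^sub>1 * (Lf\<^sup>2 / (2 * \<beta>) + \<rho> * \<beta>)) (\<beta> / \<alpha>)"
    and \<epsilon>\<^sub>2: "\<epsilon>\<^sub>2 = min (\<beta> / 2) (\<epsilon>\<^sub>1 * \<nu>\<^sub>1)"
    and \<epsilon>\<^sub>3: "\<epsilon>\<^sub>3 = max (\<epsilon>\<^sub>1 / \<rho>\<^sub>2 + \<alpha> / (2 * \<beta>) + 1 / 2) (\<epsilon>\<^sub>1 + 1 / 2)"
    and \<epsilon>\<^sub>4: "\<epsilon>\<^sub>4 = \<epsilon>\<^sub>1 * min (1 / \<rho>) (1 / 2)"
    and \<epsilon>\<^sub>5: "\<epsilon>\<^sub>5 = max (\<beta>\<^sup>2 * \<rho>\<^sup>2 + 3 * \<alpha>\<^sup>2 * \<rho>\<^sup>2 + 3 * Lf\<^sup>2) (3 * \<beta>\<^sup>2)"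
    and \<eta>: "\<eta> = sqrt 2 * max (2 * \<epsilon>\<^sub>1 / \<rho>\<^sub>2 + \<alpha> + 1) (4 * \<epsilon>\<^sub>1 + 1)"
    and h_pos: "0 < h"
    and h_less: "h < 2 * \<epsilon>\<^sub>2 * \<epsilon>\<^sub>4 / (\<eta> * \<epsilon>\<^sub>3 * \<epsilon>\<^sub>5)"
    and v_init: "\<And>i. v 0 $ i = 0"
    and x_step: "\<And>k i. x (Suc k) $ i = x k $ i
          - h *\<^sub>R (\<alpha> *\<^sub>R (\<Sum>j\<in>UNIV. L $ i $ j *\<^sub>R x k $ j) + \<beta> *\<^sub>R v k $ i + gradient (fi i) (x k $ i))"
    and v_step: "\<And>k i. v (Suc k) $ i = v k $ i + (h * \<beta>) *\<^sub>R (\<Sum>j\<in>UNIV. L $ i $ j *\<^sub>R x k $ j)"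
  shows "\<eta> > 0 \<and> (\<exists>C\<ge>0. \<forall>k. norm (x k - closest_point XX (x k))
           \<le> C * (1 - h * (2 * \<epsilon>\<^sub>2 * \<epsilon>\<^sub>4 - h * \<eta> * \<epsilon>\<^sub>3 * \<epsilon>\<^sub>5) / (4 * \<epsilon>\<^sub>3 * \<epsilon>\<^sub>4)) ^ k)"
proof -
  define T :: "real ^ 'p ^ 'n \<Rightarrow> real ^ 'p ^ 'n" where "T = block_mult L"
  interpret T: linear T
    unfolding T_def by (rule linear_block_mult)
  have T_adj: "T a \<bullet> b = a \<bullet> T b" for a b
    unfolding T_def L by (rule block_laplacian_selfadjoint[OF graph(1)])
  have T_cons: "T (consensus a) = 0" for a
    by (simp add: T_def L)
  have T_nth: "T a $ i = (\<Sum>j\<in>UNIV. L $ i $ j *\<^sub>R a $ j)" for a i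
    by (simp add: T_def block_mult_def)

  have \<rho>\<^sub>2_pos: "\<rho>\<^sub>2 > 0"
    unfolding \<rho>\<^sub>2 L by (rule block_laplacian_min_pos_eigenvalue(1)[OF graph n_ge_2])
  have "\<rho>\<^sub>2 \<le> \<bar>\<rho>\<^sub>2\<bar>" by simp
  also have "\<bar>\<rho>\<^sub>2\<bar> \<le> \<rho>"
    unfolding \<rho> \<rho>\<^sub>2 L
    by (intro abs_eigenvalue_le_spectral_radius block_laplacian_min_pos_eigenvalue(2)[OF graph n_ge_2])
  finally have \<rho>_pos: "\<rho> > 0" using \<rho>\<^sub>2_pos by simp
  have T_nonneg: "0 \<le> T a \<bullet> a" for a
    unfolding T_def L by (rule block_laplacian_nonneg[OF graph(1)])
  have T_le: "T a \<bullet> a \<le> \<rho> * (a \<bullet> a)" for a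
    unfolding T_def \<rho> using graph(1)
    by (intro block_mult_le_spectral_radius) (auto simp: L laplacian_def weighted_adjacency_def)
  have T_sq_le: "T a \<bullet> T a \<le> \<rho> * (T a \<bullet> a)" for a
    by (rule norm_sq_image_le_form[OF T.linear_axioms T_adj T_nonneg T_le \<rho>_pos])
  have T_sq_le2: "T a \<bullet> T a \<le> \<rho>\<^sup>2 * (a \<bullet> a)" for a
  proof -
    have "\<rho> * (T a \<bullet> a) \<le> \<rho> * (\<rho> * (a \<bullet> a))"
      using T_le \<rho>_pos by (intro mult_left_mono) auto
    then show ?thesis using T_sq_le[of a] by (simp add: power2_eq_square mult.assoc)
  qed
  have T_sq_ge: "\<rho>\<^sub>2 * (T a \<bullet> a) \<le> T a \<bullet> T a" for a
    unfolding T_def \<rho>\<^sub>2 L by (rule block_laplacian_norm_sq_ge_form[OF graph n_ge_2])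

  have Lfi_le: "Lfi i \<le> Lf" for i
    unfolding Lf by (intro Max_ge) auto
  have Lf_pos: "Lf > 0"
    using Lfi_pos Lfi_le by (meson less_le_trans)
  have lip: "norm (gradient (fi i) a - gradient (fi i) b) \<le> Lf * norm (a - b)" for i a b
    using lipschitz[of i a b] mult_right_mono[OF Lfi_le[of i], of "norm (a - b)"] by simp
  have n_pos: "n > 0" using n_ge_2 n by simp
  define c where "c = 2 * n * Lf\<^sup>2 + \<nu> * Lf"
  have c_pos: "c > 0"
    unfolding c_def using n_pos Lf_pos \<nu>_pos by (intro add_pos_pos) auto
  have \<alpha>': "c / (\<nu> * \<rho>\<^sub>2) < \<alpha>" using \<alpha> by (simp add: c_def)
  then have \<alpha>_pos: "\<alpha> > 0"
    using c_pos \<nu>_pos \<rho>\<^sub>2_pos by (meson divide_pos_pos less_trans mult_pos_pos)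
  have "c / \<nu> < \<alpha> * \<rho>\<^sub>2"
    using \<alpha>' \<nu>_pos \<rho>\<^sub>2_pos by (simp add: field_simps)
  then have \<nu>\<^sub>1_pos: "\<nu>\<^sub>1 > 0"
    unfolding \<nu>\<^sub>1 c_def[symmetric] using n_pos \<nu>_pos by simp
  have \<epsilon>\<^sub>1_ge: "\<beta> / \<alpha> \<le> \<epsilon>\<^sub>1" by (simp add: \<epsilon>\<^sub>1)
  have \<epsilon>\<^sub>1_pos: "\<epsilon>\<^sub>1 > 0"
    using \<epsilon>\<^sub>1_ge \<alpha>_pos \<beta> by (meson divide_pos_pos less_le_trans)
  have \<epsilon>\<^sub>1\<nu>\<^sub>1: "Lf\<^sup>2 / (2 * \<beta>) + \<rho> * \<beta> \<le> \<epsilon>\<^sub>1 * \<nu>\<^sub>1"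
  proof -
    have "1 / \<nu>\<^sub>1 * (Lf\<^sup>2 / (2 * \<beta>) + \<rho> * \<beta>) \<le> \<epsilon>\<^sub>1" by (simp add: \<epsilon>\<^sub>1)
    then show ?thesis using \<nu>\<^sub>1_pos by (simp add: pos_divide_le_eq)
  qed
  have \<epsilon>\<^sub>2_pos: "\<epsilon>\<^sub>2 > 0" using \<epsilon>\<^sub>1_pos \<nu>\<^sub>1_pos \<beta> by (simp add: \<epsilon>\<^sub>2)
  have \<epsilon>\<^sub>3_pos: "\<epsilon>\<^sub>3 > 0" using \<epsilon>\<^sub>1_pos by (simp add: \<epsilon>\<^sub>3 less_max_iff_disj)
  have \<epsilon>\<^sub>4_pos: "\<epsilon>\<^sub>4 > 0" using \<epsilon>\<^sub>1_pos \<rho>_pos by (simp add: \<epsilon>\<^sub>4)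
  have \<epsilon>\<^sub>5_pos: "\<epsilon>\<^sub>5 > 0" using \<beta> by (simp add: \<epsilon>\<^sub>5 less_max_iff_disj)
  have \<eta>_pos: "\<eta> > 0" using \<epsilon>\<^sub>1_pos by (simp add: \<eta> less_max_iff_disj)

  have gfi: "GDERIV (fi i) a :> gradient (fi i) a" for i a
    using diff by (rule gderiv_gradient)
  have gf: "GDERIV f a :> (\<Sum>i\<in>UNIV. gradient (fi i) a)" for a
    unfolding f by (intro gderiv_sum gfi)
  have grad_f: "gradient f a = (\<Sum>i\<in>UNIV. gradient (fi i) a)" for a
    using gf by (rule gradient_eqI)
  have diff_f: "f differentiable (at a)" for a
    using gf[of a] by (auto simp: gderiv_def differentiable_def)
  have "continuous_on UNIV f"
    using diff_f by (simp add: continuous_on_eq_continuous_at differentiable_imp_continuous_within)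
  then have X_closed: "closed X"
    unfolding X global_minimizers_def
    by (intro closed_Collect_all closed_Collect_le) auto
  have XX': "XX = consensus ` X" by (simp add: XX consensus_def)

  \<comment> \<open>By the singleton hypothesis \<open>- G /\<^sub>R \<beta>\<close> is the dual equilibrium for every solution at once. Since its
    blocks sum to zero, the dual error at time \<open>0\<close>, which is \<open>G /\<^sub>R \<beta>\<close>, is in the range of \<open>T\<close>.\<close>
  obtain G where G: "gradient ft ` XX = {G}"
    using singleton by (auto simp: is_singleton_def)
  have G_nth: "gradient (fi i) a = G $ i" if "a \<in> X" for a i
  proof -
    have "GDERIV ft (consensus a) :> (\<chi> i. gradient (fi i) a)"
      unfolding ft by (rule gderiv_separable) (simp add: gfi)
    then have "gradient ft (consensus a) = (\<chi> i. gradient (fi i) a)"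
      by (rule gradient_eqI)
    moreover have "gradient ft (consensus a) = G"
      using G that by (auto simp: XX')
    ultimately show ?thesis by (metis vec_lambda_beta)
  qed
  obtain a\<^sub>0 where a\<^sub>0: "a\<^sub>0 \<in> X" using X_nonempty by blast
  have "(\<Sum>i\<in>UNIV. G $ i) = 0"
    using gradient_eq_0_at_global_minimizer[OF diff_f, of a\<^sub>0] a\<^sub>0
    by (simp add: X[symmetric] grad_f G_nth)
  then have "(\<Sum>i\<in>UNIV. (G /\<^sub>R \<beta>) $ i) = 0"
    by (simp flip: scaleR_sum_right)
  then obtain q\<^sub>0 where q\<^sub>0: "T q\<^sub>0 = G /\<^sub>R \<beta>"
    unfolding T_def L by (rule block_laplacian_range[OF graph])

  define p where "p k = closest_point X (block_mean (x k))" for k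
  define y where "y k = x k - consensus (p k)" for k
  \<comment> \<open>The sequence \<open>q\<close> lifts the dual error: \<open>T (q k)\<close> is the difference of \<open>v k\<close> and the equilibrium.\<close>
  define q where "q k = q\<^sub>0 + (h * \<beta>) *\<^sub>R (\<Sum>j<k. y j)" for k
  define g where "g k = (\<chi> i. gradient (fi i) (x k $ i) - gradient (fi i) (p k))" for k
  define d where "d k = - (\<alpha> *\<^sub>R T (y k) + \<beta> *\<^sub>R T (q k) + g k)" for k
  define V where "V k = lyapunov \<epsilon>\<^sub>1 \<alpha> \<beta> T (y k) (q k)" for k
  have pX: "p k \<in> X" for k
    unfolding p_def by (rule closest_point_in_set[OF X_closed X_nonempty])
  have proj: "closest_point XX (x k) = consensus (p k)" for k
    unfolding XX' p_def by (rule closest_point_consensus_image[OF X_closed X_convex X_nonempty])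
  have Ty: "T (y k) = T (x k)" for k
    by (simp add: y_def T.diff T_cons)
  have q_Suc: "q (Suc k) = q k + (h * \<beta>) *\<^sub>R y k" for k
    by (simp add: q_def scaleR_add_right)
  have v_Suc: "v (Suc k) = v k + (h * \<beta>) *\<^sub>R T (x k)" for k
    using v_step by (simp add: vec_eq_iff[where 'b='n] T_nth)
  have Tq: "T (q k) = v k + G /\<^sub>R \<beta>" for k
  proof (induction k)
    case 0
    have "v 0 = 0" using v_init by (simp add: vec_eq_iff[where 'b='n])
    then show ?case by (simp add: q_def q\<^sub>0)
  next
    case (Suc k)
    then show ?case by (simp add: q_Suc T.add T.scaleR Ty v_Suc)
  qed
  have x_Suc: "x (Suc k) = x k + h *\<^sub>R d k" for k
  proof (rule vec_eq_iff[THEN iffD2], rule allI)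
    fix i
    have "d k $ i = - (\<alpha> *\<^sub>R T (x k) $ i + \<beta> *\<^sub>R v k $ i + gradient (fi i) (x k $ i))"
      using \<beta> G_nth[OF pX] by (simp add: d_def g_def Ty Tq scaleR_add_right)
    then show "x (Suc k) $ i = (x k + h *\<^sub>R d k) $ i"
      by (simp add: x_step T_nth scaleR_diff_right scaleR_add_right)
  qed
  have y_Suc: "y (Suc k) = y k + h *\<^sub>R d k + consensus (p k - p (Suc k))" for k
    by (simp add: y_def x_Suc linear_diff[OF linear_consensus])

  have g_sq: "g k \<bullet> g k \<le> Lf\<^sup>2 * (y k \<bullet> y k)" for k
  proof -
    have "g k \<bullet> g k = (\<Sum>i\<in>UNIV. (norm (gradient (fi i) (x k $ i) - gradient (fi i) (p k)))\<^sup>2)"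
      by (simp add: inner_vec_def[where 'b='n] g_def power2_norm_eq_inner)
    also have "\<dots> \<le> (\<Sum>i\<in>UNIV. (Lf * norm (x k $ i - p k))\<^sup>2)"
      by (intro sum_mono power_mono lip) simp
    also have "\<dots> = Lf\<^sup>2 * (y k \<bullet> y k)"
      by (simp add: inner_vec_def[where 'b='n] y_def power2_norm_eq_inner power_mult_distrib sum_distrib_left)
    finally show ?thesis .
  qed
  have coercive: "\<nu>\<^sub>1 * (y k \<bullet> y k) \<le> \<alpha> * (T (y k) \<bullet> y k) + g k \<bullet> y k" for k
  proof -
    have secant: "\<nu> * (norm (block_mean (x k) - p k))\<^sup>2
        \<le> ((\<Sum>i\<in>UNIV. gradient (fi i) (block_mean (x k))) - (\<Sum>i\<in>UNIV. gradient (fi i) (p k)))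
          \<bullet> (block_mean (x k) - p k)"
      using rsi unfolding restricted_secant_def X[symmetric] Let_def grad_f p_def by blast
    show ?thesis
      unfolding \<nu>\<^sub>1 n \<rho>\<^sub>2 y_def g_def T_def L
      using \<nu>_pos \<alpha>_pos
      by (intro laplacian_plus_gradient_coercive[OF graph n_ge_2 lip _ _ secant]) auto
  qed

  have V_ge: "\<epsilon>\<^sub>4 * (y k \<bullet> y k + T (q k) \<bullet> T (q k)) \<le> V k" for k
    unfolding \<epsilon>\<^sub>4 V_def by (rule lyapunov_lower_bound[OF \<alpha>_pos \<beta> \<rho>_pos \<epsilon>\<^sub>1_ge T_sq_le])
  have V_le: "V k \<le> \<epsilon>\<^sub>3 * (y k \<bullet> y k + T (q k) \<bullet> T (q k))" for k
    unfolding \<epsilon>\<^sub>3 V_def using \<epsilon>\<^sub>1_pos by (intro lyapunov_upper_bound \<rho>\<^sub>2_pos T_sq_ge) auto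
  define r where "r = h * (2 * \<epsilon>\<^sub>2 * \<epsilon>\<^sub>4 - h * \<eta> * \<epsilon>\<^sub>3 * \<epsilon>\<^sub>5) / (4 * \<epsilon>\<^sub>3 * \<epsilon>\<^sub>4)"
  have V_Suc: "V (Suc k) \<le> (1 - 2 * r) * V k" for k
  proof -
    \<comment> \<open>Both error terms together; \<open>V k / \<epsilon>\<^sub>3 \<le> s\<close> turns the decrease into one of \<open>V\<close>, and
      \<open>s \<le> V k / \<epsilon>\<^sub>4\<close> does the same for the second-order term.\<close>
    define s where "s = y k \<bullet> y k + T (q k) \<bullet> T (q k)"
    have "norm (y (Suc k)) \<le> norm (y k + h *\<^sub>R d k)"
    proof -
      have "dist (x (Suc k)) (closest_point XX (x (Suc k))) \<le> dist (x (Suc k)) (consensus (p k))"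
        using closed_convex_consensus_image(1)[OF X_closed X_convex] pX
        by (intro closest_point_le) (auto simp: XX')
      then show ?thesis
        by (simp add: dist_norm proj) (simp add: y_def x_Suc algebra_simps)
    qed
    then have y_le: "y (Suc k) \<bullet> y (Suc k) \<le> (y k + h *\<^sub>R d k) \<bullet> (y k + h *\<^sub>R d k)"
      by (simp add: norm_le)
    have Tqy: "T (q (Suc k)) \<bullet> y (Suc k) = T (q (Suc k)) \<bullet> (y k + h *\<^sub>R d k)"
      by (simp add: y_Suc inner_add_right T_adj[of _ "consensus _"] T_cons)
    have "V (Suc k) \<le> V k
      + h * (- 2 * \<epsilon>\<^sub>1 * (\<alpha> * (T (y k) \<bullet> y k) + g k \<bullet> y k) + \<beta> * (T (y k) \<bullet> y k)
          - \<beta> * (T (q k) \<bullet> T (q k)) - T (q k) \<bullet> g k)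
      + h\<^sup>2 * (\<epsilon>\<^sub>1 * (d k \<bullet> d k) + \<epsilon>\<^sub>1 * \<beta>\<^sup>2 * (T (y k) \<bullet> y k) + \<alpha> * \<beta> / 2 * (T (y k) \<bullet> T (y k))
          + \<beta> * (T (y k) \<bullet> d k))"
      unfolding V_def using \<epsilon>\<^sub>1_pos
      by (intro lyapunov_step[OF T.linear_axioms T_adj _ \<beta> d_def q_Suc y_le Tqy]) auto
    also have "\<dots> \<le> V k + h * (- (\<epsilon>\<^sub>2 * s)) + h\<^sup>2 * (\<eta> * \<epsilon>\<^sub>5 * s / 2)"
    proof (intro add_mono mult_left_mono order_refl)
      show "- 2 * \<epsilon>\<^sub>1 * (\<alpha> * (T (y k) \<bullet> y k) + g k \<bullet> y k) + \<beta> * (T (y k) \<bullet> y k)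
          - \<beta> * (T (q k) \<bullet> T (q k)) - T (q k) \<bullet> g k \<le> - (\<epsilon>\<^sub>2 * s)"
        unfolding \<epsilon>\<^sub>2 s_def using \<epsilon>\<^sub>1_pos
        by (intro lyapunov_first_order_bound[OF _ \<beta> coercive T_le g_sq \<epsilon>\<^sub>1\<nu>\<^sub>1]) auto
      have "2 * (\<epsilon>\<^sub>1 * (d k \<bullet> d k) + \<epsilon>\<^sub>1 * \<beta>\<^sup>2 * (T (y k) \<bullet> y k) + \<alpha> * \<beta> / 2 * (T (y k) \<bullet> T (y k))
          + \<beta> * (T (y k) \<bullet> d k)) \<le> \<eta> * \<epsilon>\<^sub>5 * s"
        unfolding \<eta> \<epsilon>\<^sub>5 s_def
        by (rule lyapunov_second_order_bound[OF \<alpha>_pos \<beta> \<rho>\<^sub>2_pos \<epsilon>\<^sub>1_ge d_def T_sq_ge T_sq_le2 g_sq])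
      then show "\<epsilon>\<^sub>1 * (d k \<bullet> d k) + \<epsilon>\<^sub>1 * \<beta>\<^sup>2 * (T (y k) \<bullet> y k) + \<alpha> * \<beta> / 2 * (T (y k) \<bullet> T (y k))
          + \<beta> * (T (y k) \<bullet> d k) \<le> \<eta> * \<epsilon>\<^sub>5 * s / 2"
        by simp
    qed (use h_pos in auto)
    also have "\<dots> \<le> V k + h * (- (\<epsilon>\<^sub>2 * (V k / \<epsilon>\<^sub>3))) + h\<^sup>2 * (\<eta> * \<epsilon>\<^sub>5 * (V k / \<epsilon>\<^sub>4) / 2)"
    proof -
      have "V k / \<epsilon>\<^sub>3 \<le> s" "s \<le> V k / \<epsilon>\<^sub>4"
        using V_le[of k] V_ge[of k] \<epsilon>\<^sub>3_pos \<epsilon>\<^sub>4_pos by (simp_all add: s_def field_simps)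
      then have 1: "\<epsilon>\<^sub>2 * (V k / \<epsilon>\<^sub>3) \<le> \<epsilon>\<^sub>2 * s" and 2: "\<eta> * \<epsilon>\<^sub>5 * s \<le> \<eta> * \<epsilon>\<^sub>5 * (V k / \<epsilon>\<^sub>4)"
        using \<epsilon>\<^sub>2_pos \<eta>_pos \<epsilon>\<^sub>5_pos by (intro mult_left_mono; simp)+
      have "h * (- (\<epsilon>\<^sub>2 * s)) \<le> h * (- (\<epsilon>\<^sub>2 * (V k / \<epsilon>\<^sub>3)))"
        using h_pos by (intro mult_left_mono le_imp_neg_le 1) simp
      moreover have "h\<^sup>2 * (\<eta> * \<epsilon>\<^sub>5 * s / 2) \<le> h\<^sup>2 * (\<eta> * \<epsilon>\<^sub>5 * (V k / \<epsilon>\<^sub>4) / 2)"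
        by (intro mult_left_mono divide_right_mono 2) simp_all
      ultimately show ?thesis
        by (intro add_mono order_refl)
    qed
    also have "\<dots> = (1 - 2 * r) * V k"
      unfolding r_def using \<epsilon>\<^sub>3_pos \<epsilon>\<^sub>4_pos by (simp add: field_simps power2_eq_square)
    finally show ?thesis .
  qed
  have "\<epsilon>\<^sub>4 * (norm (y k))\<^sup>2 \<le> V k" for k
  proof -
    have "\<epsilon>\<^sub>4 * (y k \<bullet> y k) \<le> \<epsilon>\<^sub>4 * (y k \<bullet> y k + T (q k) \<bullet> T (q k))"
      using \<epsilon>\<^sub>4_pos by (intro mult_left_mono) auto
    then show ?thesis using V_ge[of k] by (simp add: power2_norm_eq_inner)
  qed
  then have "\<exists>C\<ge>0. \<forall>k. norm (y k) \<le> C * (1 - r) ^ k"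
    by (intro norm_decay_of_square_contraction[where V = V and c = \<epsilon>\<^sub>4] \<epsilon>\<^sub>4_pos V_Suc) auto
  then show ?thesis
    using \<eta>_pos by (simp add: proj y_def r_def)
qed

end
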